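(* Let $\{P_k\}_{k\ge1}$ be a sequence of binary matrices, where $P_k$ has $m_k$ rows and $n_k$ columns and $m_k\to\infty$, $n_k\to\infty$ as $k\to\infty$. Then there exist a subsequence $\{P_{k_l}\}_{l\ge1}$ and an asymmetric graphon $W$ such that $\delta_\Box(P_{k_l},W)\to0$ as $l\to\infty$.
   Context: A binary matrix is a real matrix all of whose entries are $0$ or $1$. For an $m\times n$ real matrix $A$, the (normalized) cut norm is $\|A\|_\Box:=\frac{1}{mn}\max\{|x^TAy|: x\in\mathbb{R}^m, y\in\mathbb{R}^n, \|x\|_\infty\le1, \|y\|_\infty\le1\}$. For permutations $\pi$ of $\{1,\dots,m\}$ and $\tau$ of $\{1,\dots,n\}$, $A^{\pi,\tau}$ is the $m\times n$ matrix with $(i,j)$ entry $a_{\pi(i)\tau(j)}$. For two $m\times n$ matrices, $\delta_\Box(A,B):=\min_{\pi,\tau}\|A^{\pi,\tau}-B\|_\Box$, the minimum being over all permutations $\pi$ of the rows and $\tau$ of the columns. An asymmetric graphon is a Borel measurable function $W:[0,1]^2\to[0,1]$ (not necessarily symmetric). Its $m\times n$ discrete approximation $W_{m,n}$ is the $m\times n$ matrix whose $(i,j)$ entry is $mn\int_{(i-1)/m}^{i/m}\int_{(j-1)/n}^{j/n}W(x,y)\,dy\,dx$. For an $m\times n$ matrix $A$, $\delta_\Box(A,W):=\delta_\Box(A,W_{m,n})$. A sequence of matrices $A_k$ converges to $W$ if $\delta_\Box(A_k,W)\to0$. *)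

theory Defs
  imports "HOL-Analysis.Analysis" "HOL-Combinatorics.Permutations"
begin

text \<open>An m x n real matrix is represented by a function A :: nat => nat => real;
  only the entries A i j with i < m, j < n are relevant (0-based indices).\<close>

definition binary_matrix :: "nat \<Rightarrow> nat \<Rightarrow> (nat \<Rightarrow> nat \<Rightarrow> real) \<Rightarrow> bool" where
  "binary_matrix m n A \<longleftrightarrow> (\<forall>i<m. \<forall>j<n. A i j = 0 \<or> A i j = 1)"

definition cut_norm :: "nat \<Rightarrow> nat \<Rightarrow> (nat \<Rightarrow> nat \<Rightarrow> real) \<Rightarrow> real" where
  "cut_norm m n A = (1 / (real m * real n)) *
     Sup {\<bar>\<Sum>i<m. \<Sum>j<n. x i * A i j * y j\<bar> | x y.
            (\<forall>i<m. \<bar>x i\<bar> \<le> 1) \<and> (\<forall>j<n. \<bar>y j\<bar> \<le> 1)}"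

definition delta_box :: "nat \<Rightarrow> nat \<Rightarrow> (nat \<Rightarrow> nat \<Rightarrow> real) \<Rightarrow> (nat \<Rightarrow> nat \<Rightarrow> real) \<Rightarrow> real" where
  "delta_box m n A B = Min ((\<lambda>(\<pi>, \<tau>). cut_norm m n (\<lambda>i j. A (\<pi> i) (\<tau> j) - B i j)) `
       ({\<pi>. \<pi> permutes {..<m}} \<times> {\<tau>. \<tau> permutes {..<n}}))"

text \<open>Asymmetric graphon: Borel measurable W on the unit square with values in [0,1].
  (We require measurability/range on all of R^2; any graphon on [0,1]^2 extends this way.)\<close>
definition asym_graphon :: "(real \<Rightarrow> real \<Rightarrow> real) \<Rightarrow> bool" where
  "asym_graphon W \<longleftrightarrow> (\<lambda>z. W (fst z) (snd z)) \<in> borel_measurable (borel :: (real \<times> real) measure)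
      \<and> (\<forall>x y. 0 \<le> W x y \<and> W x y \<le> 1)"

definition discretize :: "nat \<Rightarrow> nat \<Rightarrow> (real \<Rightarrow> real \<Rightarrow> real) \<Rightarrow> nat \<Rightarrow> nat \<Rightarrow> real" where
  "discretize m n W i j = real m * real n *
     (LINT z : ({real i / real m .. real (Suc i) / real m} \<times> {real j / real n .. real (Suc j) / real n}) | lborel.
        W (fst z) (snd z))"

definition delta_box_graphon :: "nat \<Rightarrow> nat \<Rightarrow> (nat \<Rightarrow> nat \<Rightarrow> real) \<Rightarrow> (real \<Rightarrow> real \<Rightarrow> real) \<Rightarrow> real" where
  "delta_box_graphon m n A W = delta_box m n A (discretize m n W)"

end

theory Submission
  imports Defs
begin

text \<open>
  Frieze--Kannan weak regularity turns every matrix into a step matrix on boundedly many row and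
  column classes, up to a small cut norm error.  Sorting the rows and columns by their class makes
  the classes intervals, so the matrix is then also cut-close to its averages over the blocks of a
  sufficiently fine dyadic grid, the fineness depending only on the error.  Sorting only inside the
  cells of the previous grid does not disturb the coarser averages, so iterating gives one pair of
  permutations that works at all levels simultaneously.

  Along a diagonal subsequence all dyadic block densities converge.  The limits form a dyadic
  martingale with values in the unit interval; its energies increase to a limit, so by the
  Pythagorean identity it is Cauchy in the $L^1$ norm and has a limit graphon $W$.  The distance
  from the permuted matrix to the discretization of $W$ is bounded by the cut norm error of the
  dyadic averaging, the difference of the block densities from their limits together with the rows
  and columns that straddle two dyadic cells, and four times the $L^1$ distance of $W$ from the
  martingale.
\<close>

subsection \<open>Block averages\<close>

text \<open>All averaging is conditional expectation given a labelling, and two of its properties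
  drive the proof. Refining the labels raises the energy by exactly a squared distance; this bounds
  the number of regularity steps and later makes the limit densities Cauchy. Averaging over a
  product labelling does not increase the cut norm, so exchanging an irregular partition for dyadic
  cells only doubles its error and adds the cost of the cells meeting several classes. Per side
  there are at most as many such cells as classes.

  One arrangement for all levels is essential: densities read off from unrelated arrangements would
  not be averages of each other, and their limits would form no martingale. A finite matrix can
  serve only finitely many levels, hence the k-th matrix is prepared for the levels up to index k
  that its size permits.

  A further obstacle is that \<open>2 ^ N\<close> need not divide the dimensions. Cells then differ
  in size and block densities satisfy the martingale identity only in the limit; block masses are
  additive for every matrix, so convergence is extracted for masses.\<close>

definition block_avg :: "'a set \<Rightarrow> ('a \<Rightarrow> 'b) \<Rightarrow> ('a \<Rightarrow> real) \<Rightarrow> 'a \<Rightarrow> real" where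
  "block_avg X r f z = (\<Sum>w | w \<in> X \<and> r w = r z. f w) / card {w \<in> X. r w = r z}"

lemma block_avg_cong_label: "r z = r z' \<Longrightarrow> block_avg X r f z = block_avg X r f z'"
  by (simp add: block_avg_def)

lemma block_avg_fixed:
  assumes "finite X" "z \<in> X" "\<And>w. w \<in> X \<Longrightarrow> r w = r z \<Longrightarrow> g w = g z"
  shows "block_avg X r g z = g z"
proof -
  have "(\<Sum>w | w \<in> X \<and> r w = r z. g w) = (\<Sum>w | w \<in> X \<and> r w = r z. g z)"
    by (rule sum.cong) (auto intro: assms(3))
  moreover have "card {w \<in> X. r w = r z} \<noteq> 0"
    using assms(1,2) by auto
  ultimately show ?thesis by (simp add: block_avg_def)
qed

lemma block_avg_diff: "block_avg X r (\<lambda>z. f z - g z) z = block_avg X r f z - block_avg X r g z"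
  by (simp add: block_avg_def sum_subtractf diff_divide_distrib)

lemma block_avg_ge:
  assumes "finite X" "z \<in> X" "\<And>w. w \<in> X \<Longrightarrow> a \<le> f w"
  shows "a \<le> block_avg X r f z"
proof -
  have c: "card {w \<in> X. r w = r z} > 0"
    using assms(1,2) by (auto simp: card_gt_0_iff)
  have "(\<Sum>w | w \<in> X \<and> r w = r z. a) \<le> (\<Sum>w | w \<in> X \<and> r w = r z. f w)"
    by (rule sum_mono) (auto intro: assms(3))
  then show ?thesis using c by (simp add: block_avg_def field_simps)
qed

lemma block_avg_le:
  assumes "finite X" "z \<in> X" "\<And>w. w \<in> X \<Longrightarrow> f w \<le> b"
  shows "block_avg X r f z \<le> b"
proof -
  have c: "card {w \<in> X. r w = r z} > 0"
    using assms(1,2) by (auto simp: card_gt_0_iff)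
  have "(\<Sum>w | w \<in> X \<and> r w = r z. f w) \<le> (\<Sum>w | w \<in> X \<and> r w = r z. b)"
    by (rule sum_mono) (auto intro: assms(3))
  then show ?thesis using c by (simp add: block_avg_def field_simps)
qed

text \<open>Both sides are one double sum over pairs of points with equal labels: the weight is the
  reciprocal of the fibre size, which the two points of a pair share.\<close>

lemma block_avg_selfadjoint:
  assumes "finite X"
  shows "(\<Sum>z\<in>X. block_avg X r f z * g z) = (\<Sum>z\<in>X. f z * block_avg X r g z)"
proof -
  let ?c = "\<lambda>z. real (card {w \<in> X. r w = r z})"
  have "(\<Sum>z\<in>X. block_avg X r f z * g z) =
      (\<Sum>z\<in>X. \<Sum>w\<in>X. if r w = r z then f w * g z / ?c z else 0)"
    by (rule sum.cong)
      (auto simp: block_avg_def sum_distrib_right sum_divide_distrib sum.inter_filter assms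
            intro!: sum.cong)
  also have "\<dots> = (\<Sum>w\<in>X. \<Sum>z\<in>X. if r w = r z then f w * g z / ?c z else 0)"
    by (rule sum.swap)
  also have "\<dots> = (\<Sum>w\<in>X. f w * block_avg X r g w)"
    by (rule sum.cong)
      (auto simp: block_avg_def sum_distrib_left sum_divide_distrib sum.inter_filter assms
            intro!: sum.cong)
  finally show ?thesis .
qed

text \<open>The coarse average is constant on the fibres of \<open>r'\<close>, so it is unchanged
  when the fine average is moved onto it by self-adjointness; the cross term collapses to the coarse
  energy.\<close>

lemma block_avg_Pythagoras:
  assumes X: "finite X" and ref: "\<And>z w. z \<in> X \<Longrightarrow> w \<in> X \<Longrightarrow> r' z = r' w \<Longrightarrow> r z = r w"
  shows "(\<Sum>z\<in>X. (block_avg X r' f z - block_avg X r f z)\<^sup>2) =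
    (\<Sum>z\<in>X. (block_avg X r' f z)\<^sup>2) - (\<Sum>z\<in>X. (block_avg X r f z)\<^sup>2)"
proof -
  let ?E = "block_avg X r f"
  have "(\<Sum>z\<in>X. block_avg X r' f z * ?E z) = (\<Sum>z\<in>X. f z * block_avg X r' ?E z)"
    by (rule block_avg_selfadjoint[OF X])
  also have "\<dots> = (\<Sum>z\<in>X. f z * ?E z)"
    by (intro sum.cong refl arg_cong2[of _ _ _ _ "(*)"] block_avg_fixed X block_avg_cong_label ref)
  also have "\<dots> = (\<Sum>z\<in>X. f z * block_avg X r ?E z)"
    by (intro sum.cong refl arg_cong2[of _ _ _ _ "(*)"] block_avg_fixed[symmetric] X
        block_avg_cong_label)
  also have "\<dots> = (\<Sum>z\<in>X. ?E z * ?E z)"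
    by (rule block_avg_selfadjoint[OF X, symmetric])
  finally have cross: "(\<Sum>z\<in>X. block_avg X r' f z * ?E z) = (\<Sum>z\<in>X. (?E z)\<^sup>2)"
    by (simp add: power2_eq_square)
  have "(\<Sum>z\<in>X. (block_avg X r' f z - ?E z)\<^sup>2) =
      (\<Sum>z\<in>X. (block_avg X r' f z)\<^sup>2 + (?E z)\<^sup>2 - 2 * (block_avg X r' f z * ?E z))"
    by (simp add: power2_diff mult.assoc)
  also have "\<dots> = (\<Sum>z\<in>X. (block_avg X r' f z)\<^sup>2) + (\<Sum>z\<in>X. (?E z)\<^sup>2)
      - 2 * (\<Sum>z\<in>X. block_avg X r' f z * ?E z)"
    by (simp add: sum.distrib sum_subtractf sum_distrib_left)
  finally show ?thesis by (simp add: cross)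
qed

text \<open>As \<open>g\<close> is constant on the fine blocks, pairing it with the residual of
  \<open>f\<close> equals pairing it with the difference of the two averages. Cauchy-Schwarz and the
  bound 1 on \<open>g\<close> make this difference large in L2, and
  \<open>block_avg_Pythagoras\<close> reads its square as a gain of energy.\<close>

lemma energy_increment:
  fixes \<epsilon> :: real
  assumes X: "finite X"
    and ref: "\<And>z w. z \<in> X \<Longrightarrow> w \<in> X \<Longrightarrow> r' z = r' w \<Longrightarrow> r z = r w"
    and g: "\<And>z w. z \<in> X \<Longrightarrow> w \<in> X \<Longrightarrow> r' z = r' w \<Longrightarrow> g z = g w"
    and g1: "\<And>z. z \<in> X \<Longrightarrow> \<bar>g z\<bar> \<le> 1"
    and big: "\<bar>\<Sum>z\<in>X. (f z - block_avg X r f z) * g z\<bar> \<ge> \<epsilon> * card X" and e: "\<epsilon> \<ge> 0"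
  shows "(\<Sum>z\<in>X. (block_avg X r' f z)\<^sup>2) \<ge> (\<Sum>z\<in>X. (block_avg X r f z)\<^sup>2) + \<epsilon>\<^sup>2 * card X"
proof (cases "card X = 0")
  case True
  with X show ?thesis by simp
next
  case False
  let ?d = "\<lambda>z. block_avg X r' f z - block_avg X r f z"
  have "(\<Sum>z\<in>X. (f z - block_avg X r f z) * g z)
      = (\<Sum>z\<in>X. (f z - block_avg X r f z) * block_avg X r' g z)"
    by (intro sum.cong refl arg_cong2[of _ _ _ _ "(*)"] block_avg_fixed[symmetric] X g)
  also have "\<dots> = (\<Sum>z\<in>X. block_avg X r' (\<lambda>z. f z - block_avg X r f z) z * g z)"
    by (rule block_avg_selfadjoint[OF X, symmetric])
  also have "\<dots> = (\<Sum>z\<in>X. ?d z * g z)"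
    unfolding block_avg_diff
    by (intro sum.cong refl arg_cong2[of _ _ _ _ "(*)"] arg_cong2[of _ _ _ _ "(-)"]
         block_avg_fixed X block_avg_cong_label ref)
  finally have eq: "(\<Sum>z\<in>X. (f z - block_avg X r f z) * g z) = (\<Sum>z\<in>X. ?d z * g z)" .
  have "(\<epsilon> * card X)\<^sup>2 \<le> (\<bar>\<Sum>z\<in>X. ?d z * g z\<bar>)\<^sup>2"
    using big e unfolding eq by (intro power_mono) auto
  also have "\<dots> \<le> (\<Sum>z\<in>X. (?d z)\<^sup>2) * (\<Sum>z\<in>X. (g z)\<^sup>2)"
    using Cauchy_Schwarz_ineq_sum by simp
  also have "\<dots> \<le> (\<Sum>z\<in>X. (?d z)\<^sup>2) * (\<Sum>z\<in>X. 1)"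
  proof (intro mult_left_mono sum_mono sum_nonneg)
    fix z assume "z \<in> X"
    then show "(g z)\<^sup>2 \<le> 1" using g1 by (simp add: abs_square_le_1)
  qed auto
  finally have "\<epsilon>\<^sup>2 * card X \<le> (\<Sum>z\<in>X. (?d z)\<^sup>2)"
    using False by (simp add: power2_eq_square mult.assoc mult.left_commute)
  moreover have "(\<Sum>z\<in>X. (?d z)\<^sup>2) =
      (\<Sum>z\<in>X. (block_avg X r' f z)\<^sup>2) - (\<Sum>z\<in>X. (block_avg X r f z)\<^sup>2)"
    by (rule block_avg_Pythagoras[OF X]) (rule ref)
  ultimately show ?thesis by simp
qed

text \<open>Fibres of a product labelling are rectangles, so averaging sends rank one test functions
  to rank one test functions. This is what makes block averages contract the cut norm.\<close>

lemma block_avg_times: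
  assumes "finite X" "finite Y"
  shows "block_avg (X \<times> Y) (map_prod p q) (\<lambda>z. x (fst z) * y (snd z)) (i, j) =
    block_avg X p x i * block_avg Y q y j"
proof -
  have *: "{w \<in> X \<times> Y. map_prod p q w = map_prod p q (i, j)} =
      {i' \<in> X. p i' = p i} \<times> {j' \<in> Y. q j' = q j}"
    by auto
  show ?thesis
    unfolding block_avg_def *
    by (simp add: card_cartesian_product sum_product sum.cartesian_product split_beta)
qed

lemma block_avg_reindex:
  assumes "bij_betw \<sigma> X X"
  shows "block_avg X (r \<circ> \<sigma>) (f \<circ> \<sigma>) z = block_avg X r f (\<sigma> z)"
proof -
  have b: "bij_betw \<sigma> {w \<in> X. r (\<sigma> w) = r (\<sigma> z)} {w \<in> X. r w = r (\<sigma> z)}"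
    using assms unfolding bij_betw_def by (auto simp: inj_on_def)
  show ?thesis
    unfolding block_avg_def
    using sum.reindex_bij_betw[OF b, of f] bij_betw_same_card[OF b] by simp
qed

subsection \<open>Cut norm bounds and weak regularity\<close>

text \<open>A predicate replaces the norm so that no supremum has to be shown finite and bounds can
  simply be added. Test vectors are bounded at every index, also beyond \<open>m\<close> and
  \<open>n\<close>; those values never enter the sum, so truncation by 0 restores the bound when
  needed.\<close>

definition cut_le :: "nat \<Rightarrow> nat \<Rightarrow> (nat \<times> nat \<Rightarrow> real) \<Rightarrow> real \<Rightarrow> bool" where
  "cut_le m n f \<epsilon> \<longleftrightarrow> (\<forall>x y. (\<forall>i. \<bar>x i\<bar> \<le> 1) \<longrightarrow> (\<forall>j. \<bar>y j\<bar> \<le> 1) \<longrightarrow>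
     \<bar>\<Sum>z\<in>{..<m} \<times> {..<n}. f z * (x (fst z) * y (snd z))\<bar> \<le> \<epsilon> * (real m * real n))"

lemma abs_sum_le_sum_sign:
  fixes y v :: "'a \<Rightarrow> real"
  assumes "\<And>j. j \<in> J \<Longrightarrow> \<bar>y j\<bar> \<le> 1"
  shows "\<bar>\<Sum>j\<in>J. v j * y j\<bar> \<le> (\<Sum>j\<in>J. v j * (if v j \<ge> 0 then 1 else -1))"
proof -
  have "\<bar>\<Sum>j\<in>J. v j * y j\<bar> \<le> (\<Sum>j\<in>J. \<bar>v j * y j\<bar>)" by (rule sum_abs)
  also have "\<dots> \<le> (\<Sum>j\<in>J. v j * (if v j \<ge> 0 then 1 else -1))"
  proof (rule sum_mono)
    fix j assume "j \<in> J"
    then have "\<bar>v j\<bar> * \<bar>y j\<bar> \<le> \<bar>v j\<bar> * 1"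
      by (intro mult_left_mono assms) auto
    then show "\<bar>v j * y j\<bar> \<le> v j * (if v j \<ge> 0 then 1 else -1)"
      by (auto simp: abs_mult)
  qed
  finally show ?thesis .
qed

text \<open>A bilinear form on a product of cubes attains its maximum at a pair of vertices; sign vectors
  are what allows a violation of the cut norm bound to be used as a two-fold refinement.\<close>

lemma cut_leI_signs:
  assumes "\<And>x y. (\<And>i. x i = 1 \<or> x i = -1) \<Longrightarrow> (\<And>j. y j = 1 \<or> y j = -1) \<Longrightarrow>
     \<bar>\<Sum>z\<in>{..<m} \<times> {..<n}. f z * (x (fst z) * y (snd z))\<bar> \<le> \<epsilon> * (real m * real n)"
  shows "cut_le m n f \<epsilon>"
  unfolding cut_le_def
proof (intro allI impI)
  fix x y :: "nat \<Rightarrow> real"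
  assume x: "\<forall>i. \<bar>x i\<bar> \<le> 1" and y: "\<forall>j. \<bar>y j\<bar> \<le> 1"
  let ?S = "\<lambda>x y. \<Sum>z\<in>{..<m} \<times> {..<n}. f z * (x (fst z) * y (snd z))"
  have S: "?S x y = (\<Sum>i<m. \<Sum>j<n. f (i, j) * (x i * y j))" for x y
    by (simp add: sum.cartesian_product split_beta)
  have cols: "?S x y = (\<Sum>j<n. (\<Sum>i<m. f (i, j) * x i) * y j)" for x y
    unfolding S by (subst sum.swap) (simp add: sum_distrib_right mult.assoc)
  have rows: "?S x y = (\<Sum>i<m. (\<Sum>j<n. f (i, j) * y j) * x i)" for x y
    unfolding S by (simp add: sum_distrib_right sum_distrib_left mult_ac)
  \<comment> \<open>Rounding is done one variable at a time: \<open>y'\<close> is the best choice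
    for \<open>x\<close>, and \<open>x'\<close> is then the best choice for
    \<open>y'\<close>.\<close>
  define y' :: "nat \<Rightarrow> real" where "y' j = (if (\<Sum>i<m. f (i, j) * x i) \<ge> 0 then 1 else -1)" for j
  define x' :: "nat \<Rightarrow> real" where "x' i = (if (\<Sum>j<n. f (i, j) * y' j) \<ge> 0 then 1 else -1)" for i
  have "\<bar>?S x y\<bar> \<le> ?S x y'"
    unfolding cols unfolding y'_def using y by (intro abs_sum_le_sum_sign) auto
  also have "\<dots> \<le> \<bar>?S x y'\<bar>" by simp
  also have "\<dots> \<le> ?S x' y'"
    unfolding rows unfolding x'_def using x by (intro abs_sum_le_sum_sign) auto
  also have "\<dots> \<le> \<bar>?S x' y'\<bar>" by simp
  also have "\<dots> \<le> \<epsilon> * (real m * real n)"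
    by (rule assms) (auto simp: x'_def y'_def)
  finally show "\<bar>?S x y\<bar> \<le> \<epsilon> * (real m * real n)" .
qed

text \<open>A failure of the bound is witnessed by sign vectors. Appending the signs to the labels
  as a last binary digit makes the product of the sign vectors constant on the new blocks, so
  \<open>energy_increment\<close> applies. \<open>m * n > 0\<close> is recorded because it makes the
  gain strictly positive.\<close>

lemma weak_regularity_step:
  fixes p q :: "nat \<Rightarrow> nat"
  assumes "\<not> cut_le m n (\<lambda>z. f z - block_avg ({..<m} \<times> {..<n}) (map_prod p q) f z) \<epsilon>"
    and "\<epsilon> > 0"
  shows "\<exists>b c :: nat \<Rightarrow> nat. (\<forall>i. b i < 2) \<and> (\<forall>j. c j < 2) \<and> m * n > 0 \<and>
    (\<Sum>z\<in>{..<m} \<times> {..<n}. (block_avg ({..<m} \<times> {..<n})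
        (map_prod (\<lambda>i. 2 * p i + b i) (\<lambda>j. 2 * q j + c j)) f z)\<^sup>2) \<ge>
     (\<Sum>z\<in>{..<m} \<times> {..<n}. (block_avg ({..<m} \<times> {..<n}) (map_prod p q) f z)\<^sup>2)
       + \<epsilon>\<^sup>2 * (real m * real n)"
proof -
  let ?X = "{..<m} \<times> {..<n}"
  have "\<exists>x y. (\<forall>i. x i = 1 \<or> x i = -1) \<and> (\<forall>j. y j = 1 \<or> y j = -1) \<and>
      \<not> \<bar>\<Sum>z\<in>?X. (f z - block_avg ?X (map_prod p q) f z) * (x (fst z) * y (snd z))\<bar>
         \<le> \<epsilon> * (real m * real n)"
  proof (rule ccontr)
    assume *: "\<not> ?thesis"
    have "cut_le m n (\<lambda>z. f z - block_avg ?X (map_prod p q) f z) \<epsilon>"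
    proof (rule cut_leI_signs)
      fix x y :: "nat \<Rightarrow> real"
      assume xy: "\<And>i. x i = 1 \<or> x i = -1" "\<And>j. y j = 1 \<or> y j = -1"
      show "\<bar>\<Sum>z\<in>?X. (f z - block_avg ?X (map_prod p q) f z) * (x (fst z) * y (snd z))\<bar>
         \<le> \<epsilon> * (real m * real n)"
        using * xy by blast
    qed
    with assms(1) show False by simp
  qed
  then obtain x y :: "nat \<Rightarrow> real"
    where x: "\<And>i. x i = 1 \<or> x i = -1" and y: "\<And>j. y j = 1 \<or> y j = -1"
      and big: "\<not> \<bar>\<Sum>z\<in>?X. (f z - block_avg ?X (map_prod p q) f z) * (x (fst z) * y (snd z))\<bar>
         \<le> \<epsilon> * (real m * real n)"
    by blast
  define b c :: "nat \<Rightarrow> nat" where "b i = (if x i = 1 then 1 else 0)"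
    and "c j = (if y j = 1 then 1 else 0)" for i j
  have b: "u = u' \<and> x i = x i'" if "2 * u + b i = 2 * u' + b i'" for u u' i i'
    using that x[of i] x[of i'] by (auto simp: b_def split: if_splits; presburger)
  have c: "u = u' \<and> y i = y i'" if "2 * u + c i = 2 * u' + c i'" for u u' i i'
    using that y[of i] y[of i'] by (auto simp: c_def split: if_splits; presburger)
  have "m * n > 0"
    using big by (intro notI gr0I) auto
  moreover have "(\<Sum>z\<in>?X. (block_avg ?X (map_prod (\<lambda>i. 2 * p i + b i) (\<lambda>j. 2 * q j + c j)) f z)\<^sup>2) \<ge>
     (\<Sum>z\<in>?X. (block_avg ?X (map_prod p q) f z)\<^sup>2) + \<epsilon>\<^sup>2 * card ?X"
  proof (rule energy_increment[where g = "\<lambda>z. x (fst z) * y (snd z)"])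
    fix z
    show "\<bar>x (fst z) * y (snd z)\<bar> \<le> 1"
      using x[of "fst z"] y[of "snd z"] by auto
  next
    fix z w
    assume "map_prod (\<lambda>i. 2 * p i + b i) (\<lambda>j. 2 * q j + c j) z =
      map_prod (\<lambda>i. 2 * p i + b i) (\<lambda>j. 2 * q j + c j) w"
    then have "2 * p (fst z) + b (fst z) = 2 * p (fst w) + b (fst w)"
      "2 * q (snd z) + c (snd z) = 2 * q (snd w) + c (snd w)"
      by (simp_all add: map_prod_def split_beta)
    from b[OF this(1)] c[OF this(2)]
    show "x (fst z) * y (snd z) = x (fst w) * y (snd w)" "map_prod p q z = map_prod p q w"
      by (simp_all add: map_prod_def split_beta)
  qed (use big assms(2) in auto)
  ultimately show ?thesis
    by - (rule exI[of _ b], rule exI[of _ c], auto simp: b_def c_def)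
qed

text \<open>\<open>T\<close> counts the refinements still affordable: each gains at least
  \<open>\<epsilon>\<^sup>2 * (real m * real n)\<close>, while the energy never exceeds
  \<open>real m * real n\<close>. At \<open>T = 0\<close> the ceiling is already reached, and one
  more violation would overshoot it. The implications between label inequalities say more than
  refinement: sorting by the new labels also sorts by the old ones.\<close>

lemma weak_regularity_aux:
  fixes p q :: "nat \<Rightarrow> nat" and \<epsilon> :: real
  assumes "\<epsilon> > 0" and f: "\<And>z. z \<in> {..<m} \<times> {..<n} \<Longrightarrow> 0 \<le> f z \<and> f z \<le> 1"
    and "\<And>i. i < m \<Longrightarrow> p i < K" "\<And>j. j < n \<Longrightarrow> q j < K"
    and "(\<Sum>z\<in>{..<m} \<times> {..<n}. (block_avg ({..<m} \<times> {..<n}) (map_prod p q) f z)\<^sup>2)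
       + real T * \<epsilon>\<^sup>2 * (real m * real n) \<ge> real m * real n"
  shows "\<exists>p' q'. (\<forall>i<m. p' i < K * 2 ^ T) \<and> (\<forall>j<n. q' j < K * 2 ^ T) \<and>
     (\<forall>i i'. p' i \<le> p' i' \<longrightarrow> p i \<le> p i') \<and> (\<forall>j j'. q' j \<le> q' j' \<longrightarrow> q j \<le> q j') \<and>
     cut_le m n (\<lambda>z. f z - block_avg ({..<m} \<times> {..<n}) (map_prod p' q') f z) \<epsilon>"
  using assms(3-)
proof (induction T arbitrary: p q K)
  case 0
  let ?X = "{..<m} \<times> {..<n}"
  show ?case
  proof (rule ccontr)
    assume "\<not> ?case"
    have "\<not> cut_le m n (\<lambda>z. f z - block_avg ?X (map_prod p q) f z) \<epsilon>"
    proof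
      assume "cut_le m n (\<lambda>z. f z - block_avg ?X (map_prod p q) f z) \<epsilon>"
      then have ?case
        by - (rule exI[of _ p], rule exI[of _ q], simp add: 0)
      with \<open>\<not> ?case\<close> show False ..
    qed
    then obtain b c :: "nat \<Rightarrow> nat" where bc: "m * n > 0"
      "(\<Sum>z\<in>?X. (block_avg ?X (map_prod (\<lambda>i. 2 * p i + b i) (\<lambda>j. 2 * q j + c j)) f z)\<^sup>2) \<ge>
        (\<Sum>z\<in>?X. (block_avg ?X (map_prod p q) f z)\<^sup>2) + \<epsilon>\<^sup>2 * (real m * real n)"
      using weak_regularity_step[of m n f p q, OF _ assms(1)] by blast
    have "(\<Sum>z\<in>?X. (block_avg ?X (map_prod (\<lambda>i. 2 * p i + b i) (\<lambda>j. 2 * q j + c j)) f z)\<^sup>2)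
        \<le> (\<Sum>z\<in>?X. 1)"
      using f by (intro sum_mono power_le_one block_avg_ge block_avg_le) auto
    moreover have "\<epsilon>\<^sup>2 * (real m * real n) > 0"
      using bc(1) assms(1) by simp
    ultimately show False using bc(2) 0(3) by simp
  qed
next
  case (Suc T)
  let ?X = "{..<m} \<times> {..<n}"
  show ?case
  proof (cases "cut_le m n (\<lambda>z. f z - block_avg ?X (map_prod p q) f z) \<epsilon>")
    case True
    have "u < K * 2 ^ Suc T" if "u < K" for u
      using that by (rule less_le_trans) simp
    then show ?thesis
      using True Suc.prems(1,2) by - (rule exI[of _ p], rule exI[of _ q], blast)
  next
    case False
    then obtain b c :: "nat \<Rightarrow> nat" where bc: "\<And>i. b i < 2" "\<And>j. c j < 2"
      "(\<Sum>z\<in>?X. (block_avg ?X (map_prod (\<lambda>i. 2 * p i + b i) (\<lambda>j. 2 * q j + c j)) f z)\<^sup>2) \<ge>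
        (\<Sum>z\<in>?X. (block_avg ?X (map_prod p q) f z)\<^sup>2) + \<epsilon>\<^sup>2 * (real m * real n)"
      using weak_regularity_step[of m n f p q, OF _ assms(1)] by blast
    have lt: "2 * u + v < 2 * K" if "u < K" "v < 2" for u v using that by linarith
    have mono: "u \<le> u'" if "2 * u + v \<le> 2 * u' + v'" "v' < 2" for u v u' v' :: nat
      using that by linarith
    have "\<exists>p' q'. (\<forall>i<m. p' i < 2 * K * 2 ^ T) \<and> (\<forall>j<n. q' j < 2 * K * 2 ^ T) \<and>
      (\<forall>i i'. p' i \<le> p' i' \<longrightarrow> 2 * p i + b i \<le> 2 * p i' + b i') \<and>
      (\<forall>j j'. q' j \<le> q' j' \<longrightarrow> 2 * q j + c j \<le> 2 * q j' + c j') \<and>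
      cut_le m n (\<lambda>z. f z - block_avg ?X (map_prod p' q') f z) \<epsilon>"
    proof (rule Suc.IH)
      show "2 * p i + b i < 2 * K" if "i < m" for i
        using lt Suc.prems(1) bc(1) that by blast
      show "2 * q j + c j < 2 * K" if "j < n" for j
        using lt Suc.prems(2) bc(2) that by blast
      show "(\<Sum>z\<in>?X. (block_avg ?X (map_prod (\<lambda>i. 2 * p i + b i) (\<lambda>j. 2 * q j + c j)) f z)\<^sup>2)
          + real T * \<epsilon>\<^sup>2 * (real m * real n) \<ge> real m * real n"
        using bc(3) Suc.prems(3) by (simp add: distrib_right)
    qed
    then obtain p' q' where pq: "\<forall>i<m. p' i < 2 * K * 2 ^ T" "\<forall>j<n. q' j < 2 * K * 2 ^ T"
      "\<forall>i i'. p' i \<le> p' i' \<longrightarrow> 2 * p i + b i \<le> 2 * p i' + b i'"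
      "\<forall>j j'. q' j \<le> q' j' \<longrightarrow> 2 * q j + c j \<le> 2 * q j' + c j'"
      "cut_le m n (\<lambda>z. f z - block_avg ?X (map_prod p' q') f z) \<epsilon>"
      by blast
    show ?thesis
    proof (rule exI[of _ p'], rule exI[of _ q'], intro conjI allI impI)
      show "p i \<le> p i'" if "p' i \<le> p' i'" for i i'
        using mono bc(1) pq(3) that by blast
      show "q j \<le> q j'" if "q' j \<le> q' j'" for j j'
        using mono bc(2) pq(4) that by blast
    qed (use pq(1,2,5) in \<open>simp_all add: mult_ac\<close>)
  qed
qed

text \<open>The initial labels are arbitrary so that the resulting partition can refine the cells of
  an earlier level. The range of labels grows by a factor governed by \<epsilon> alone; the budget
  condition holds at the start because energy is nonnegative.\<close>

lemma weak_regularity: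
  fixes p q :: "nat \<Rightarrow> nat" and \<epsilon> :: real
  assumes "\<epsilon> > 0" and f: "\<And>z. z \<in> {..<m} \<times> {..<n} \<Longrightarrow> 0 \<le> f z \<and> f z \<le> 1"
    and "\<And>i. i < m \<Longrightarrow> p i < K" "\<And>j. j < n \<Longrightarrow> q j < K" and T: "T \<ge> 1 / \<epsilon>\<^sup>2"
  shows "\<exists>p' q'. (\<forall>i<m. p' i < K * 2 ^ T) \<and> (\<forall>j<n. q' j < K * 2 ^ T) \<and>
     (\<forall>i i'. p' i \<le> p' i' \<longrightarrow> p i \<le> p i') \<and> (\<forall>j j'. q' j \<le> q' j' \<longrightarrow> q j \<le> q j') \<and>
     cut_le m n (\<lambda>z. f z - block_avg ({..<m} \<times> {..<n}) (map_prod p' q') f z) \<epsilon>"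
proof -
  have "1 \<le> real T * \<epsilon>\<^sup>2" using T assms(1) by (simp add: field_simps)
  then have "1 * (real m * real n) \<le> real T * \<epsilon>\<^sup>2 * (real m * real n)"
    by (intro mult_right_mono) auto
  moreover have "(\<Sum>z\<in>{..<m} \<times> {..<n}. (block_avg ({..<m} \<times> {..<n}) (map_prod p q) f z)\<^sup>2) \<ge> 0"
    by (intro sum_nonneg) auto
  ultimately have "(\<Sum>z\<in>{..<m} \<times> {..<n}. (block_avg ({..<m} \<times> {..<n}) (map_prod p q) f z)\<^sup>2)
       + real T * \<epsilon>\<^sup>2 * (real m * real n) \<ge> real m * real n" by simp
  with assms(1) f assms(3,4) show ?thesis
    by (rule weak_regularity_aux)
qed

section \<open>Arithmetic of cut norm bounds\<close>

lemma cut_leD: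
  assumes "cut_le m n f \<epsilon>" "\<And>i. \<bar>x i\<bar> \<le> 1" "\<And>j. \<bar>y j\<bar> \<le> 1"
  shows "\<bar>\<Sum>z\<in>{..<m} \<times> {..<n}. f z * (x (fst z) * y (snd z))\<bar> \<le> \<epsilon> * (real m * real n)"
  using assms unfolding cut_le_def by blast

lemma cut_leI:
  assumes "\<And>x y. (\<And>i. \<bar>x i\<bar> \<le> 1) \<Longrightarrow> (\<And>j. \<bar>y j\<bar> \<le> 1) \<Longrightarrow>
    \<bar>\<Sum>z\<in>{..<m} \<times> {..<n}. f z * (x (fst z) * y (snd z))\<bar> \<le> \<epsilon> * (real m * real n)"
  shows "cut_le m n f \<epsilon>"
  using assms unfolding cut_le_def by simp

lemma cut_le_cong:
  assumes "cut_le m n f \<epsilon>" "\<And>i j. i < m \<Longrightarrow> j < n \<Longrightarrow> f (i, j) = g (i, j)"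
  shows "cut_le m n g \<epsilon>"
proof (rule cut_leI)
  fix x y :: "nat \<Rightarrow> real"
  assume "\<And>i. \<bar>x i\<bar> \<le> 1" "\<And>j. \<bar>y j\<bar> \<le> 1"
  then have "\<bar>\<Sum>z\<in>{..<m} \<times> {..<n}. f z * (x (fst z) * y (snd z))\<bar> \<le> \<epsilon> * (real m * real n)"
    by (rule cut_leD[OF assms(1)])
  moreover have "(\<Sum>z\<in>{..<m} \<times> {..<n}. f z * (x (fst z) * y (snd z))) =
      (\<Sum>z\<in>{..<m} \<times> {..<n}. g z * (x (fst z) * y (snd z)))"
    by (rule sum.cong) (auto simp: assms(2))
  ultimately show "\<bar>\<Sum>z\<in>{..<m} \<times> {..<n}. g z * (x (fst z) * y (snd z))\<bar> \<le> \<epsilon> * (real m * real n)"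
    by simp
qed

lemma cut_le_add:
  assumes "cut_le m n f a" "cut_le m n g b"
  shows "cut_le m n (\<lambda>z. f z + g z) (a + b)"
proof (rule cut_leI)
  fix x y :: "nat \<Rightarrow> real"
  assume "\<And>i. \<bar>x i\<bar> \<le> 1" "\<And>j. \<bar>y j\<bar> \<le> 1"
  then show "\<bar>\<Sum>z\<in>{..<m} \<times> {..<n}. (f z + g z) * (x (fst z) * y (snd z))\<bar>
      \<le> (a + b) * (real m * real n)"
    using cut_leD[OF assms(1), of x y] cut_leD[OF assms(2), of x y]
    by (simp add: distrib_right sum.distrib)
qed

lemma cut_le_uminus:
  assumes "cut_le m n f a"
  shows "cut_le m n (\<lambda>z. - f z) a"
proof (rule cut_leI)
  fix x y :: "nat \<Rightarrow> real"
  assume "\<And>i. \<bar>x i\<bar> \<le> 1" "\<And>j. \<bar>y j\<bar> \<le> 1"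
  then show "\<bar>\<Sum>z\<in>{..<m} \<times> {..<n}. - f z * (x (fst z) * y (snd z))\<bar> \<le> a * (real m * real n)"
    using cut_leD[OF assms, of x y] by (simp add: sum_negf)
qed

lemma cut_le_L1:
  assumes "(\<Sum>z\<in>{..<m} \<times> {..<n}. \<bar>f z\<bar>) \<le> \<epsilon> * (real m * real n)"
  shows "cut_le m n f \<epsilon>"
proof (rule cut_leI)
  fix x y :: "nat \<Rightarrow> real"
  assume x: "\<And>i. \<bar>x i\<bar> \<le> 1" and y: "\<And>j. \<bar>y j\<bar> \<le> 1"
  have "\<bar>\<Sum>z\<in>{..<m} \<times> {..<n}. f z * (x (fst z) * y (snd z))\<bar>
      \<le> (\<Sum>z\<in>{..<m} \<times> {..<n}. \<bar>f z * (x (fst z) * y (snd z))\<bar>)" by (rule sum_abs)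
  also have "\<dots> \<le> (\<Sum>z\<in>{..<m} \<times> {..<n}. \<bar>f z\<bar>)"
  proof (rule sum_mono)
    fix z
    have "\<bar>x (fst z)\<bar> * \<bar>y (snd z)\<bar> \<le> 1 * 1"
      by (intro mult_mono x y) auto
    then have "\<bar>f z\<bar> * (\<bar>x (fst z)\<bar> * \<bar>y (snd z)\<bar>) \<le> \<bar>f z\<bar> * 1"
      by (intro mult_left_mono) auto
    then show "\<bar>f z * (x (fst z) * y (snd z))\<bar> \<le> \<bar>f z\<bar>" by (simp add: abs_mult)
  qed
  finally show "\<bar>\<Sum>z\<in>{..<m} \<times> {..<n}. f z * (x (fst z) * y (snd z))\<bar> \<le> \<epsilon> * (real m * real n)"
    using assms by linarith
qed

lemma bij_betw_map_prod_permutes: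
  assumes "\<sigma> permutes A" "\<tau> permutes B"
  shows "bij_betw (map_prod \<sigma> \<tau>) (A \<times> B) (A \<times> B)"
  using bij_betw_map_prod[OF permutes_imp_bij[OF assms(1)] permutes_imp_bij[OF assms(2)]] .

lemma cut_le_permute:
  assumes f: "cut_le m n f \<epsilon>" and \<sigma>: "\<sigma> permutes {..<m}" and \<tau>: "\<tau> permutes {..<n}"
  shows "cut_le m n (f \<circ> map_prod \<sigma> \<tau>) \<epsilon>"
proof (rule cut_leI)
  fix x y :: "nat \<Rightarrow> real"
  assume xy: "\<And>i. \<bar>x i\<bar> \<le> 1" "\<And>j. \<bar>y j\<bar> \<le> 1"
  let ?g = "\<lambda>z. f z * (x (inv \<sigma> (fst z)) * y (inv \<tau> (snd z)))"
  have "(\<Sum>z\<in>{..<m} \<times> {..<n}. (f \<circ> map_prod \<sigma> \<tau>) z * (x (fst z) * y (snd z))) =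
     (\<Sum>z\<in>{..<m} \<times> {..<n}. ?g (map_prod \<sigma> \<tau> z))"
    using permutes_inverses[OF \<sigma>] permutes_inverses[OF \<tau>] by (intro sum.cong) auto
  also have "\<dots> = (\<Sum>z\<in>{..<m} \<times> {..<n}. ?g z)"
    by (rule sum.reindex_bij_betw[OF bij_betw_map_prod_permutes[OF \<sigma> \<tau>]])
  finally show "\<bar>\<Sum>z\<in>{..<m} \<times> {..<n}. (f \<circ> map_prod \<sigma> \<tau>) z * (x (fst z) * y (snd z))\<bar>
      \<le> \<epsilon> * (real m * real n)"
    using cut_leD[OF f, of "\<lambda>i. x (inv \<sigma> i)" "\<lambda>j. y (inv \<tau> j)"] xy by simp
qed

text \<open>Self-adjointness moves the averaging onto the test function, which by
  \<open>block_avg_times\<close> becomes the product of two averaged vectors. Their entries still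
  lie between -1 and 1, so they are admissible test vectors for \<open>f\<close>.\<close>

lemma cut_le_block_avg:
  assumes f: "cut_le m n f \<epsilon>"
  shows "cut_le m n (block_avg ({..<m} \<times> {..<n}) (map_prod p q) f) \<epsilon>"
proof (rule cut_leI)
  fix x y :: "nat \<Rightarrow> real"
  assume x: "\<And>i. \<bar>x i\<bar> \<le> 1" and y: "\<And>j. \<bar>y j\<bar> \<le> 1"
  \<comment> \<open>The value 0 beyond the range makes the bound hold at every index, as
    \<open>cut_leD\<close> demands.\<close>
  define x' where "x' i = (if i < m then block_avg {..<m} p x i else 0)" for i
  define y' where "y' j = (if j < n then block_avg {..<n} q y j else 0)" for j
  have x': "\<bar>x' i\<bar> \<le> 1" for i
    using block_avg_ge[of "{..<m}" i "-1" x p] block_avg_le[of "{..<m}" i x 1 p] x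
    by (auto simp: x'_def abs_le_iff minus_le_iff)
  have y': "\<bar>y' i\<bar> \<le> 1" for i
    using block_avg_ge[of "{..<n}" i "-1" y q] block_avg_le[of "{..<n}" i y 1 q] y
    by (auto simp: y'_def abs_le_iff minus_le_iff)
  have "(\<Sum>z\<in>{..<m} \<times> {..<n}. block_avg ({..<m} \<times> {..<n}) (map_prod p q) f z
        * (x (fst z) * y (snd z))) =
      (\<Sum>z\<in>{..<m} \<times> {..<n}. f z
        * block_avg ({..<m} \<times> {..<n}) (map_prod p q) (\<lambda>z. x (fst z) * y (snd z)) z)"
    by (rule block_avg_selfadjoint) simp
  also have "\<dots> = (\<Sum>z\<in>{..<m} \<times> {..<n}. f z * (x' (fst z) * y' (snd z)))"
    by (rule sum.cong) (auto simp: block_avg_times x'_def y'_def)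
  finally show "\<bar>\<Sum>z\<in>{..<m} \<times> {..<n}. block_avg ({..<m} \<times> {..<n}) (map_prod p q) f z
        * (x (fst z) * y (snd z))\<bar> \<le> \<epsilon> * (real m * real n)"
    using cut_leD[OF f, of x' y', OF x' y'] by simp
qed

text \<open>Entries in the exceptional rows \<open>R\<close> or columns \<open>S\<close> are charged
  the trivial bound 1, all others \<delta>. The exceptions will be the rows and columns in cells
  with several labels, and later those straddling two dyadic intervals.\<close>

lemma sum_grid_le:
  fixes h :: "nat \<times> nat \<Rightarrow> real"
  assumes R: "R \<subseteq> {..<m}" and S: "S \<subseteq> {..<n}" and "\<delta> \<ge> 0"
    and h1: "\<And>i j. i < m \<Longrightarrow> j < n \<Longrightarrow> h (i, j) \<le> 1"
    and h\<delta>: "\<And>i j. i < m \<Longrightarrow> j < n \<Longrightarrow> i \<notin> R \<Longrightarrow> j \<notin> S \<Longrightarrow> h (i, j) \<le> \<delta>"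
  shows "(\<Sum>z\<in>{..<m} \<times> {..<n}. h z) \<le>
    \<delta> * (real m * real n) + real (card R) * real n + real m * real (card S)"
proof -
  have fin: "finite R" "finite S" using R S finite_subset by auto
  have "(\<Sum>z\<in>{..<m} \<times> {..<n}. h z) \<le> (\<Sum>z\<in>{..<m} \<times> {..<n}.
      \<delta> + of_bool (z \<in> R \<times> {..<n}) + of_bool (z \<in> {..<m} \<times> S))"
  proof (rule sum_mono)
    fix z assume z: "z \<in> {..<m} \<times> {..<n}"
    then show "h z \<le> \<delta> + of_bool (z \<in> R \<times> {..<n}) + of_bool (z \<in> {..<m} \<times> S)"
      using h1[of "fst z" "snd z"] h\<delta>[of "fst z" "snd z"] \<open>\<delta> \<ge> 0\<close>
      by (cases z) (auto simp: of_bool_def)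
  qed
  also have "\<dots> = \<delta> * (real m * real n) + real (card (({..<m} \<times> {..<n}) \<inter> (R \<times> {..<n})))
      + real (card (({..<m} \<times> {..<n}) \<inter> ({..<m} \<times> S)))"
    by (simp add: sum.distrib sum.If_cases of_bool_def Int_def mult.commute)
  also have "({..<m} \<times> {..<n}) \<inter> (R \<times> {..<n}) = R \<times> {..<n}" using R by auto
  also have "({..<m} \<times> {..<n}) \<inter> ({..<m} \<times> S) = {..<m} \<times> S" using S by auto
  finally show ?thesis by (simp add: card_cartesian_product)
qed

subsection \<open>Dyadic cells and sorting\<close>

text \<open>For \<open>i < m\<close> this is the index of the level \<open>N\<close> dyadic interval
  that contains the left endpoint \<open>i / m\<close> of the interval belonging to row
  \<open>i\<close>. No divisibility between \<open>m\<close> and \<open>2 ^ N\<close> is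
  required.\<close>

definition cell :: "nat \<Rightarrow> nat \<Rightarrow> nat \<Rightarrow> nat" where
  "cell m N i = i * 2 ^ N div m"

lemma cell_mono: "i \<le> j \<Longrightarrow> cell m N i \<le> cell m N j"
  unfolding cell_def by (intro div_le_mono mult_le_mono1)

lemma cell_less: "i < m \<Longrightarrow> cell m N i < 2 ^ N"
  unfolding cell_def by (simp add: less_mult_imp_div_less mult.commute)

text \<open>Iterated integer division makes the cells nest exactly, even when \<open>2 ^ N\<close>
  does not divide \<open>m\<close>. Hence permutations respecting fine cells respect coarse ones,
  and masses of fine cells add up.\<close>

lemma cell_coarsen:
  assumes "N \<le> N'"
  shows "cell m N' i div 2 ^ (N' - N) = cell m N i"
proof -
  have "cell m N' i div 2 ^ (N' - N) = i * 2 ^ N' div (m * 2 ^ (N' - N))"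
    unfolding cell_def by (rule div_mult2_eq[symmetric])
  also have "(2::nat) ^ N' = 2 ^ N * 2 ^ (N' - N)"
    using assms by (simp flip: power_add)
  finally show ?thesis by (simp add: cell_def mult.assoc[symmetric])
qed

text \<open>The cell consists of the integers in a half-open real interval of length
  \<open>m / 2 ^ N\<close>; rounding both ends up changes the length by at most 1.\<close>

lemma card_cell:
  assumes "a < 2 ^ N"
  shows "\<bar>real (card {i. i < m \<and> cell m N i = a}) - real m / 2 ^ N\<bar> \<le> 1"
proof (cases "m = 0")
  case False
  define u v where "u = real a * real m / 2 ^ N" and "v = (real a + 1) * real m / 2 ^ N"
  have uv: "0 \<le> u" "u \<le> v" "v - u = real m / 2 ^ N"
    by (auto simp: u_def v_def divide_right_mono field_simps)
  have "i < m \<and> cell m N i = a \<longleftrightarrow> i \<in> {nat \<lceil>u\<rceil>..<nat \<lceil>v\<rceil>}" for i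
  proof -
    have "i < m \<and> cell m N i = a \<longleftrightarrow> cell m N i = a"
    proof -
      have "i < m" if "cell m N i = a"
      proof (rule ccontr)
        assume "\<not> i < m"
        then have "cell m N m \<le> cell m N i" by (intro cell_mono) simp
        then show False using that assms False by (simp add: cell_def)
      qed
      then show ?thesis by blast
    qed
    also have "\<dots> \<longleftrightarrow> a * m \<le> i * 2 ^ N \<and> i * 2 ^ N < (a + 1) * m"
    proof
      assume "cell m N i = a"
      then show "a * m \<le> i * 2 ^ N \<and> i * 2 ^ N < (a + 1) * m"
        using div_times_less_eq_dividend[of "i * 2 ^ N" m] dividend_less_div_times[of m "i * 2 ^ N"]
          False by (auto simp: cell_def algebra_simps)
    next
      assume "a * m \<le> i * 2 ^ N \<and> i * 2 ^ N < (a + 1) * m"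
      then show "cell m N i = a"
        unfolding cell_def by (intro div_nat_eqI) (auto simp: mult.commute)
    qed
    also have "\<dots> \<longleftrightarrow> real (a * m) \<le> real (i * 2 ^ N) \<and> real (i * 2 ^ N) < real ((a + 1) * m)"
      by (simp only: of_nat_le_iff of_nat_less_iff)
    also have "\<dots> \<longleftrightarrow> u \<le> real i \<and> real i < v"
      by (simp add: u_def v_def field_simps)
    also have "\<dots> \<longleftrightarrow> i \<in> {nat \<lceil>u\<rceil>..<nat \<lceil>v\<rceil>}"
      using uv by (auto simp: nat_le_iff ceiling_le_iff zless_nat_eq_int_zless less_ceiling_iff)
    finally show ?thesis .
  qed
  then have "{i. i < m \<and> cell m N i = a} = {nat \<lceil>u\<rceil>..<nat \<lceil>v\<rceil>}" by blast
  then have "real (card {i. i < m \<and> cell m N i = a}) = real_of_int \<lceil>v\<rceil> - real_of_int \<lceil>u\<rceil>"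
  proof -
    have "0 \<le> \<lceil>u\<rceil>" "\<lceil>u\<rceil> \<le> \<lceil>v\<rceil>" using uv by (simp_all add: ceiling_mono)
    then have "int (nat \<lceil>v\<rceil> - nat \<lceil>u\<rceil>) = \<lceil>v\<rceil> - \<lceil>u\<rceil>"
      by (metis int_nat_eq of_nat_diff nat_mono order_trans)
    then have "real_of_int (int (nat \<lceil>v\<rceil> - nat \<lceil>u\<rceil>)) = real_of_int \<lceil>v\<rceil> - real_of_int \<lceil>u\<rceil>"
      by simp
    then show ?thesis
      by (simp only: \<open>{i. i < m \<and> cell m N i = a} = {nat \<lceil>u\<rceil>..<nat \<lceil>v\<rceil>}\<close>
          card_atLeastLessThan of_int_of_nat_eq)
  qed
  then show ?thesis using uv by linarith
qed simp

lemma cut_le_mono: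
  assumes "cut_le m n f \<epsilon>" "\<epsilon> \<le> \<epsilon>'"
  shows "cut_le m n f \<epsilon>'"
proof (rule cut_leI)
  fix x y :: "nat \<Rightarrow> real"
  assume "\<And>i. \<bar>x i\<bar> \<le> 1" "\<And>j. \<bar>y j\<bar> \<le> 1"
  then have "\<bar>\<Sum>z\<in>{..<m} \<times> {..<n}. f z * (x (fst z) * y (snd z))\<bar> \<le> \<epsilon> * (real m * real n)"
    by (rule cut_leD[OF assms(1)])
  also have "\<dots> \<le> \<epsilon>' * (real m * real n)"
    using assms(2) by (intro mult_right_mono) auto
  finally show "\<bar>\<Sum>z\<in>{..<m} \<times> {..<n}. f z * (x (fst z) * y (snd z))\<bar> \<le> \<epsilon>' * (real m * real n)" .
qed

text \<open>The sorted rearrangement of \<^term>\<open>c :: nat \<Rightarrow> nat\<close> is monotone, and so is \<^term>\<open>c :: nat \<Rightarrow> nat\<close> itself; two monotone rearrangements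
  of one another coincide.\<close>

lemma sorting_permutation:
  fixes p c :: "nat \<Rightarrow> nat"
  assumes mono: "\<And>i j. i \<le> j \<Longrightarrow> c i \<le> c j" and ref: "\<And>i j. p i \<le> p j \<Longrightarrow> c i \<le> c j"
  shows "\<exists>\<sigma>. \<sigma> permutes {..<m} \<and> (\<forall>i j. i \<le> j \<longrightarrow> j < m \<longrightarrow> p (\<sigma> i) \<le> p (\<sigma> j)) \<and>
    (\<forall>i<m. c (\<sigma> i) = c i)"
proof -
  define zs where "zs = sort_key p [0..<m]"
  have len: "length zs = m" by (simp add: zs_def)
  have "mset zs = mset [0..<m]" by (simp add: zs_def)
  then obtain \<sigma> where \<sigma>: "\<sigma> permutes {..<length [0..<m]}" "permute_list \<sigma> [0..<m] = zs"
    by (rule mset_eq_permutation)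
  have \<sigma>m: "\<sigma> permutes {..<m}" using \<sigma>(1) by simp
  have lt: "\<sigma> i < m" if "i < m" for i
    using permutes_in_image[OF \<sigma>m, of i] that by simp
  have nth: "zs ! i = \<sigma> i" if "i < m" for i
    using permute_list_nth[OF \<sigma>(1), of i] that lt by (simp add: \<sigma>(2))
  have "sorted (map p zs)" by (simp add: zs_def)
  then have p: "p (\<sigma> i) \<le> p (\<sigma> j)" if "i \<le> j" "j < m" for i j
    using sorted_nth_mono[of "map p zs" i j] that by (simp add: len nth)
  have "map c zs = map c [0..<m]"
  proof (rule properties_for_sort[THEN trans[OF sym]])
    show "mset (map c zs) = mset (map c zs)" ..
    show "sorted (map c zs)"
      using p ref by (auto simp: sorted_iff_nth_mono len nth)
    show "sort (map c zs) = map c [0..<m]"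
    proof (rule properties_for_sort)
      show "mset (map c [0..<m]) = mset (map c zs)"
        by (simp only: mset_map \<open>mset zs = mset [0..<m]\<close>)
      show "sorted (map c [0..<m])"
        using mono by (auto simp: sorted_iff_nth_mono)
    qed
  qed
  then have "c (\<sigma> i) = c i" if "i < m" for i
    using that nth[OF that] by (metis add_0 len length_upt minus_nat.diff_0 nth_map nth_upt)
  with \<sigma>m p show ?thesis by blast
qed

text \<open>A cell on which the monotone labelling is not constant contains the first index whose label
  reaches some \<^term>\<open>v :: nat\<close>, so there are at most \<^term>\<open>K :: nat\<close> such cells.\<close>

lemma card_split_cells:
  assumes mono: "\<And>i j. i \<le> j \<Longrightarrow> j < m \<Longrightarrow> p i \<le> p j" and K: "\<And>i. i < m \<Longrightarrow> p i < (K :: nat)"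
    and m: "2 ^ N \<le> m"
  shows "real (card {i. i < m \<and> (\<exists>i'<m. cell m N i' = cell m N i \<and> p i' \<noteq> p i)}) \<le>
     real K * (2 * real m / 2 ^ N)"
proof -
  let ?B = "{i. i < m \<and> (\<exists>i'<m. cell m N i' = cell m N i \<and> p i' \<noteq> p i)}"
  define first where "first v = (LEAST i. i < m \<and> v \<le> p i)" for v
  have between: "cell m N (first (p j)) = cell m N i \<and> first (p j) < m"
    if "p i < p j" "i < m" "j < m" "cell m N i = cell m N j" for i j
  proof -
    have le: "first (p j) \<le> j" unfolding first_def by (rule Least_le) (use that in auto)
    have f: "first (p j) < m \<and> p j \<le> p (first (p j))"
      unfolding first_def by (rule LeastI[of _ j]) (use that in auto)
    then have "i \<le> first (p j)" using mono[of "first (p j)" i] that by (cases "i \<le> first (p j)") auto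
    then show ?thesis
      using f le cell_mono[of i "first (p j)" m N] cell_mono[of "first (p j)" j m N] that by auto
  qed
  \<comment> \<open>If no index carries a label of at least \<open>v\<close>, then
    \<open>LEAST\<close> is unspecified; the condition \<open>first v < m\<close> keeps only values
    of \<open>first v\<close> that are row indices.\<close>
  have "?B \<subseteq> (\<Union>v\<in>{v. v < K \<and> first v < m}. {i. i < m \<and> cell m N i = cell m N (first v)})"
  proof
    fix i assume "i \<in> ?B"
    then obtain i' where i: "i < m" "i' < m" "cell m N i' = cell m N i" "p i' \<noteq> p i" by auto
    show "i \<in> (\<Union>v\<in>{v. v < K \<and> first v < m}. {i. i < m \<and> cell m N i = cell m N (first v)})"
    proof (cases "p i < p i'")
      case True
      then show ?thesis using between[of i i'] i K[of i'] by auto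
    next
      case False
      then have "p i' < p i" using i by simp
      then show ?thesis using between[of i' i] i K[of i] by auto
    qed
  qed
  then have "card ?B \<le> card (\<Union>v\<in>{v. v < K \<and> first v < m}.
      {i. i < m \<and> cell m N i = cell m N (first v)})"
    by (intro card_mono) auto
  also have "\<dots> \<le> (\<Sum>v | v < K \<and> first v < m. card {i. i < m \<and> cell m N i = cell m N (first v)})"
    by (rule card_UN_le) simp
  finally have "real (card ?B) \<le>
      (\<Sum>v | v < K \<and> first v < m. real (card {i. i < m \<and> cell m N i = cell m N (first v)}))"
    by (simp flip: of_nat_sum)
  also have "\<dots> \<le> (\<Sum>v | v < K \<and> first v < m. 2 * real m / 2 ^ N)"
  proof (rule sum_mono)
    fix v assume "v \<in> {v. v < K \<and> first v < m}"
    then have "cell m N (first v) < 2 ^ N" by (simp add: cell_less)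
    then have "\<bar>real (card {i. i < m \<and> cell m N i = cell m N (first v)}) - real m / 2 ^ N\<bar> \<le> 1"
      by (rule card_cell)
    \<comment> \<open>The size assumption absorbs the rounding error 1 into the average cell size,
      which is the source of the factor 2.\<close>
    moreover have "1 \<le> real m / 2 ^ N"
      using m by (simp add: field_simps)
    ultimately show "real (card {i. i < m \<and> cell m N i = cell m N (first v)}) \<le> 2 * real m / 2 ^ N"
      unfolding times_divide_eq_right[symmetric] by linarith
  qed
  also have "\<dots> \<le> real K * (2 * real m / 2 ^ N)"
  proof -
    have "card {v. v < K \<and> first v < m} \<le> card {..<K}" by (rule card_mono) auto
    then show ?thesis
      by (simp add: mult_right_mono del: times_divide_eq_right)
  qed
  finally show ?thesis .
qed

section \<open>Averages over dyadic cells\<close>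

definition cell_avg :: "nat \<Rightarrow> nat \<Rightarrow> nat \<Rightarrow> (nat \<times> nat \<Rightarrow> real) \<Rightarrow> nat \<times> nat \<Rightarrow> real" where
  "cell_avg m n N f = block_avg ({..<m} \<times> {..<n}) (map_prod (cell m N) (cell n N)) f"

text \<open>With monotone labels the classes of \<open>g\<close> are intervals, so \<open>g\<close>
  agrees with its cell average except in rows or columns whose cell meets several classes.
  \<open>card_split_cells\<close> gives each side a share of at most \<open>2 * K / 2 ^ N\<close>;
  the two sides together give the constant 4.\<close>

lemma cell_avg_step_function:
  fixes p q :: "nat \<Rightarrow> nat"
  assumes p: "\<And>i j. i \<le> j \<Longrightarrow> j < m \<Longrightarrow> p i \<le> p j" "\<And>i. i < m \<Longrightarrow> p i < K"
    and q: "\<And>i j. i \<le> j \<Longrightarrow> j < n \<Longrightarrow> q i \<le> q j" "\<And>j. j < n \<Longrightarrow> q j < K"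
    and mn: "2 ^ N \<le> m" "2 ^ N \<le> n"
    and g01: "\<And>z. z \<in> {..<m} \<times> {..<n} \<Longrightarrow> 0 \<le> g z \<and> g z \<le> 1"
    and g: "\<And>z w. map_prod p q z = map_prod p q w \<Longrightarrow> g z = g w"
  shows "cut_le m n (\<lambda>z. g z - cell_avg m n N g z) (4 * real K / 2 ^ N)"
proof (rule cut_le_L1)
  let ?X = "{..<m} \<times> {..<n}"
  let ?B = "\<lambda>m p. {i. i < m \<and> (\<exists>i'<m. cell m N i' = cell m N i \<and> p i' \<noteq> p i)}"
  have "(\<Sum>z\<in>?X. \<bar>g z - cell_avg m n N g z\<bar>) \<le>
      0 * (real m * real n) + real (card (?B m p)) * real n + real m * real (card (?B n q))"
  proof (rule sum_grid_le)
    show "?B m p \<subseteq> {..<m}" "?B n q \<subseteq> {..<n}" by blast+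
    show "(0::real) \<le> 0" by simp
  next
    fix i j assume ij: "i < m" "j < n"
    then have z: "(i, j) \<in> ?X" by simp
    have "0 \<le> cell_avg m n N g (i, j)"
      unfolding cell_avg_def by (rule block_avg_ge) (use z g01 in auto)
    moreover have "cell_avg m n N g (i, j) \<le> 1"
      unfolding cell_avg_def by (rule block_avg_le) (use z g01 in auto)
    ultimately show "\<bar>g (i, j) - cell_avg m n N g (i, j)\<bar> \<le> 1"
      using g01[OF z] by (simp add: abs_le_iff)
  next
    fix i j assume ij: "i < m" "j < n" and good: "i \<notin> ?B m p" "j \<notin> ?B n q"
    have "cell_avg m n N g (i, j) = g (i, j)"
      unfolding cell_avg_def
    proof (rule block_avg_fixed)
      fix w assume w: "w \<in> ?X" "map_prod (cell m N) (cell n N) w = map_prod (cell m N) (cell n N) (i, j)"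
      then have "fst w < m" "snd w < n" "cell m N (fst w) = cell m N i" "cell n N (snd w) = cell n N j"
        by (simp_all add: map_prod_def split_beta mem_Times_iff)
      then have "p (fst w) = p i" "q (snd w) = q j"
        using good ij by blast+
      then show "g w = g (i, j)" by (intro g) (simp add: map_prod_def split_beta)
    qed (use ij in simp_all)
    then show "\<bar>g (i, j) - cell_avg m n N g (i, j)\<bar> \<le> 0" by simp
  qed
  also have "\<dots> \<le> (real K * (2 * real m / 2 ^ N)) * real n + real m * (real K * (2 * real n / 2 ^ N))"
  proof -
    have "real (card (?B m p)) \<le> real K * (2 * real m / 2 ^ N)"
      by (rule card_split_cells) (assumption | rule p mn)+
    moreover have "real (card (?B n q)) \<le> real K * (2 * real n / 2 ^ N)"
      by (rule card_split_cells) (assumption | rule q mn)+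
    ultimately show ?thesis
      by (simp add: add_mono mult_left_mono mult_right_mono del: times_divide_eq_right)
  qed
  also have "\<dots> = 4 * real K / 2 ^ N * (real m * real n)"
    by (simp add: field_simps)
  finally show "(\<Sum>z\<in>?X. \<bar>g z - cell_avg m n N g z\<bar>) \<le> 4 * real K / 2 ^ N * (real m * real n)" .
qed

text \<open>The residual of \<open>f\<close> is \<open>f - g\<close>, minus the cell average of
  \<open>f - g\<close>, plus the residual of \<open>g\<close>. The first two terms cost \<delta>
  each, the second one by contraction, so \<open>g\<close> need not be related to the cells of
  \<open>f\<close> in any other way.\<close>

lemma cut_le_cell_avg_residual:
  assumes h: "cut_le m n (\<lambda>z. f z - g z) \<delta>" and g: "cut_le m n (\<lambda>z. g z - cell_avg m n N g z) \<eta>"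
  shows "cut_le m n (\<lambda>z. f z - cell_avg m n N f z) (2 * \<delta> + \<eta>)"
proof -
  have "cut_le m n (cell_avg m n N (\<lambda>z. f z - g z)) \<delta>"
    unfolding cell_avg_def by (rule cut_le_block_avg[OF h])
  from cut_le_add[OF cut_le_add[OF h cut_le_uminus[OF this]] g]
  have "cut_le m n (\<lambda>z. f z - g z + - cell_avg m n N (\<lambda>z. f z - g z) z
      + (g z - cell_avg m n N g z)) (\<delta> + \<delta> + \<eta>)" .
  moreover have "(\<lambda>z. f z - g z + - cell_avg m n N (\<lambda>z. f z - g z) z + (g z - cell_avg m n N g z))
      = (\<lambda>z. f z - cell_avg m n N f z)"
    by (simp add: cell_avg_def block_avg_diff)
  ultimately show ?thesis by simp
qed

text \<open>\<open>N'\<close> is chosen before the matrix is seen. Regularity starts from the cells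
  of level \<open>N\<close>, so sorting by the resulting labels moves rows and columns only inside
  those cells. The regularity error \<epsilon>/4 enters twice; the other half of \<epsilon> pays for
  cells with several labels, whence the requirement that \<open>2 ^ N'\<close> exceed
  \<open>8 * real K / \<epsilon>\<close>.\<close>

lemma sorted_regularity:
  assumes "\<epsilon> > 0"
  shows "\<exists>N'>N. \<forall>m n f. 2 ^ N' \<le> m \<longrightarrow> 2 ^ N' \<le> n \<longrightarrow>
    (\<forall>z\<in>{..<m} \<times> {..<n}. 0 \<le> f z \<and> f z \<le> 1) \<longrightarrow>
    (\<exists>\<sigma> \<tau>. \<sigma> permutes {..<m} \<and> \<tau> permutes {..<n} \<and>
      (\<forall>i<m. cell m N (\<sigma> i) = cell m N i) \<and> (\<forall>j<n. cell n N (\<tau> j) = cell n N j) \<and>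
      cut_le m n (\<lambda>z. (f \<circ> map_prod \<sigma> \<tau>) z - cell_avg m n N' (f \<circ> map_prod \<sigma> \<tau>) z) \<epsilon>)"
proof -
  define T where "T = nat \<lceil>1 / (\<epsilon> / 4)\<^sup>2\<rceil>"
  have T: "1 / (\<epsilon> / 4)\<^sup>2 \<le> real T" unfolding T_def by (rule real_nat_ceiling_ge)
  \<comment> \<open>Labels start as cell indices below \<open>2 ^ N\<close>, and each of at most
    \<open>T\<close> refinements doubles their range.\<close>
  define K :: nat where "K = 2 ^ N * 2 ^ T"
  obtain N0 where N0: "8 * real K / \<epsilon> < 2 ^ N0"
    using real_arch_pow[of 2 "8 * real K / \<epsilon>"] by auto
  define N' where "N' = max (Suc N) N0"
  have "(2::real) ^ N0 \<le> 2 ^ N'" by (simp add: N'_def)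
  with N0 have N': "8 * real K / \<epsilon> < 2 ^ N'" by linarith
  show ?thesis
  proof (rule exI[of _ N'], intro conjI allI impI)
    show "N < N'" by (simp add: N'_def)
    fix m n :: nat and f :: "nat \<times> nat \<Rightarrow> real"
    assume mn: "2 ^ N' \<le> m" "2 ^ N' \<le> n"
      and "\<forall>z\<in>{..<m} \<times> {..<n}. 0 \<le> f z \<and> f z \<le> 1"
    then have f: "\<And>z. z \<in> {..<m} \<times> {..<n} \<Longrightarrow> 0 \<le> f z \<and> f z \<le> 1" by blast
    let ?X = "{..<m} \<times> {..<n}"
    have "\<exists>p q. (\<forall>i<m. p i < 2 ^ N * (2::nat) ^ T) \<and> (\<forall>j<n. q j < 2 ^ N * (2::nat) ^ T) \<and>
      (\<forall>i i'. p i \<le> p i' \<longrightarrow> cell m N i \<le> cell m N i') \<and>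
      (\<forall>j j'. q j \<le> q j' \<longrightarrow> cell n N j \<le> cell n N j') \<and>
      cut_le m n (\<lambda>z. f z - block_avg ?X (map_prod p q) f z) (\<epsilon> / 4)"
    proof (rule weak_regularity)
      show "\<epsilon> / 4 > 0" using assms by simp
      show "1 / (\<epsilon> / 4)\<^sup>2 \<le> real T" by (rule T)
    qed (rule f cell_less; assumption)+
    then obtain p q where pq: "\<forall>i<m. p i < K" "\<forall>j<n. q j < K"
      "\<forall>i i'. p i \<le> p i' \<longrightarrow> cell m N i \<le> cell m N i'"
      "\<forall>j j'. q j \<le> q j' \<longrightarrow> cell n N j \<le> cell n N j'"
      "cut_le m n (\<lambda>z. f z - block_avg ?X (map_prod p q) f z) (\<epsilon> / 4)"
      unfolding K_def by blast
    have "\<exists>\<sigma>. \<sigma> permutes {..<m} \<and> (\<forall>i j. i \<le> j \<longrightarrow> j < m \<longrightarrow> p (\<sigma> i) \<le> p (\<sigma> j)) \<and>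
        (\<forall>i<m. cell m N (\<sigma> i) = cell m N i)"
    proof (rule sorting_permutation)
      show "cell m N i \<le> cell m N j" if "i \<le> j" for i j
        using that by (rule cell_mono)
      show "cell m N i \<le> cell m N j" if "p i \<le> p j" for i j
        using pq(3) that by blast
    qed
    then obtain \<sigma> where \<sigma>: "\<sigma> permutes {..<m}" "\<And>i j. i \<le> j \<Longrightarrow> j < m \<Longrightarrow> p (\<sigma> i) \<le> p (\<sigma> j)"
        "\<And>i. i < m \<Longrightarrow> cell m N (\<sigma> i) = cell m N i"
      by blast
    have "\<exists>\<tau>. \<tau> permutes {..<n} \<and> (\<forall>i j. i \<le> j \<longrightarrow> j < n \<longrightarrow> q (\<tau> i) \<le> q (\<tau> j)) \<and>
        (\<forall>i<n. cell n N (\<tau> i) = cell n N i)"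
    proof (rule sorting_permutation)
      show "cell n N i \<le> cell n N j" if "i \<le> j" for i j
        using that by (rule cell_mono)
      show "cell n N i \<le> cell n N j" if "q i \<le> q j" for i j
        using pq(4) that by blast
    qed
    then obtain \<tau> where \<tau>: "\<tau> permutes {..<n}" "\<And>i j. i \<le> j \<Longrightarrow> j < n \<Longrightarrow> q (\<tau> i) \<le> q (\<tau> j)"
        "\<And>i. i < n \<Longrightarrow> cell n N (\<tau> i) = cell n N i"
      by blast
    have lt: "\<sigma> i < m" if "i < m" for i using permutes_in_image[OF \<sigma>(1), of i] that by simp
    have lt': "\<tau> i < n" if "i < n" for i using permutes_in_image[OF \<tau>(1), of i] that by simp
    \<comment> \<open>The step approximation in sorted order: its labels
      \<open>p \<circ> \<sigma>\<close> and \<open>q \<circ> \<tau>\<close> are monotone.\<close>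
    define g where "g = block_avg ?X (map_prod p q) f \<circ> map_prod \<sigma> \<tau>"
    have 1: "cut_le m n (\<lambda>z. (f \<circ> map_prod \<sigma> \<tau>) z - g z) (\<epsilon> / 4)"
      using cut_le_permute[OF pq(5) \<sigma>(1) \<tau>(1)] by (simp add: g_def comp_def)
    have 2: "cut_le m n (\<lambda>z. g z - cell_avg m n N' g z) (4 * real K / 2 ^ N')"
    proof (rule cell_avg_step_function[where p = "p \<circ> \<sigma>" and q = "q \<circ> \<tau>"])
      fix z assume "z \<in> ?X"
      then have "map_prod \<sigma> \<tau> z \<in> ?X" using lt lt' by auto
      have "0 \<le> g z"
        unfolding g_def comp_def by (rule block_avg_ge) (use \<open>map_prod \<sigma> \<tau> z \<in> ?X\<close> f in simp_all)
      moreover have "g z \<le> 1"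
        unfolding g_def comp_def by (rule block_avg_le) (use \<open>map_prod \<sigma> \<tau> z \<in> ?X\<close> f in simp_all)
      ultimately show "0 \<le> g z \<and> g z \<le> 1" ..
    next
      fix z w assume "map_prod (p \<circ> \<sigma>) (q \<circ> \<tau>) z = map_prod (p \<circ> \<sigma>) (q \<circ> \<tau>) w"
      then show "g z = g w"
        unfolding g_def comp_def by (intro block_avg_cong_label) (simp add: map_prod_def split_beta)
    next
      show "(p \<circ> \<sigma>) i \<le> (p \<circ> \<sigma>) j" if "i \<le> j" "j < m" for i j
        using \<sigma>(2) that by simp
      show "(q \<circ> \<tau>) i \<le> (q \<circ> \<tau>) j" if "i \<le> j" "j < n" for i j
        using \<tau>(2) that by simp
      show "(p \<circ> \<sigma>) i < K" if "i < m" for i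
        using pq(1) lt[OF that] by simp
      show "(q \<circ> \<tau>) i < K" if "i < n" for i
        using pq(2) lt'[OF that] by simp
    qed (rule mn)+
    have "4 * real K / 2 ^ N' \<le> \<epsilon> / 2"
      using N' assms by (simp add: field_simps)
    then have "2 * (\<epsilon> / 4) + 4 * real K / 2 ^ N' \<le> \<epsilon>" by simp
    then have "cut_le m n (\<lambda>z. (f \<circ> map_prod \<sigma> \<tau>) z
        - cell_avg m n N' (f \<circ> map_prod \<sigma> \<tau>) z) \<epsilon>"
      by (rule cut_le_mono[OF cut_le_cell_avg_residual[OF 1 2]])
    then show "\<exists>\<sigma> \<tau>. \<sigma> permutes {..<m} \<and> \<tau> permutes {..<n} \<and>
      (\<forall>i<m. cell m N (\<sigma> i) = cell m N i) \<and> (\<forall>j<n. cell n N (\<tau> j) = cell n N j) \<and>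
      cut_le m n (\<lambda>z. (f \<circ> map_prod \<sigma> \<tau>) z - cell_avg m n N' (f \<circ> map_prod \<sigma> \<tau>) z) \<epsilon>"
      by - (rule exI[of _ \<sigma>], rule exI[of _ \<tau>], intro conjI allI impI \<sigma> \<tau>)
  qed
qed

lemma block_avg_cong_on:
  assumes "\<And>w. w \<in> X \<Longrightarrow> r w = r' w" "z \<in> X"
  shows "block_avg X r f z = block_avg X r' f z"
proof -
  have "{w \<in> X. r w = r z} = {w \<in> X. r' w = r' z}" using assms by auto
  then show ?thesis by (simp add: block_avg_def)
qed

text \<open>A permutation that stays inside the cells commutes with cell averaging, so the residual
  is itself only permuted, and cut bounds are invariant under permutations.\<close>

lemma cut_le_cell_preserving:
  assumes h: "cut_le m n (\<lambda>z. f z - cell_avg m n N f z) \<epsilon>"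
    and \<sigma>: "\<sigma> permutes {..<m}" and \<tau>: "\<tau> permutes {..<n}"
    and c: "\<And>i. i < m \<Longrightarrow> cell m N (\<sigma> i) = cell m N i" "\<And>j. j < n \<Longrightarrow> cell n N (\<tau> j) = cell n N j"
  shows "cut_le m n (\<lambda>z. (f \<circ> map_prod \<sigma> \<tau>) z - cell_avg m n N (f \<circ> map_prod \<sigma> \<tau>) z) \<epsilon>"
proof (rule cut_le_cong[OF cut_le_permute[OF h \<sigma> \<tau>]])
  fix i j assume ij: "i < m" "j < n"
  let ?X = "{..<m} \<times> {..<n}" and ?r = "map_prod (cell m N) (cell n N)"
  have "block_avg ?X ?r (f \<circ> map_prod \<sigma> \<tau>) (i, j) =
      block_avg ?X (?r \<circ> map_prod \<sigma> \<tau>) (f \<circ> map_prod \<sigma> \<tau>) (i, j)"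
    by (rule block_avg_cong_on) (use ij c in auto)
  also have "\<dots> = block_avg ?X ?r f (map_prod \<sigma> \<tau> (i, j))"
    by (rule block_avg_reindex[OF bij_betw_map_prod_permutes[OF \<sigma> \<tau>]])
  finally show "((\<lambda>z. f z - cell_avg m n N f z) \<circ> map_prod \<sigma> \<tau>) (i, j) =
      (f \<circ> map_prod \<sigma> \<tau>) (i, j) - cell_avg m n N (f \<circ> map_prod \<sigma> \<tau>) (i, j)"
    by (simp add: cell_avg_def)
qed

text \<open>The levels \<open>L\<close> are fixed once for all matrices, each chosen relative to its
  predecessor; only the permutations depend on the matrix and on \<open>t\<close>. A level too fine
  for the matrix carries no claim, and the induction then keeps the permutations as they
  are.\<close>

lemma simultaneous_regularity:
  "\<exists>L :: nat \<Rightarrow> nat. strict_mono L \<and> (\<forall>m n f t. (\<forall>z\<in>{..<m} \<times> {..<n}. 0 \<le> f z \<and> f z \<le> 1) \<longrightarrow>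
     (\<exists>\<sigma> \<tau>. \<sigma> permutes {..<m} \<and> \<tau> permutes {..<n} \<and>
       (\<forall>s\<le>t. 2 ^ L s \<le> m \<longrightarrow> 2 ^ L s \<le> n \<longrightarrow>
         cut_le m n (\<lambda>z. (f \<circ> map_prod \<sigma> \<tau>) z - cell_avg m n (L s) (f \<circ> map_prod \<sigma> \<tau>) z)
           (1 / real (Suc s)))))"
proof -
  define good where "good N N' \<epsilon> \<longleftrightarrow> N < N' \<and> (\<forall>m n f. 2 ^ N' \<le> m \<longrightarrow> 2 ^ N' \<le> n \<longrightarrow>
    (\<forall>z\<in>{..<m} \<times> {..<n}. 0 \<le> f z \<and> f z \<le> 1) \<longrightarrow>
    (\<exists>\<sigma> \<tau>. \<sigma> permutes {..<m} \<and> \<tau> permutes {..<n} \<and>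
      (\<forall>i<m. cell m N (\<sigma> i) = cell m N i) \<and> (\<forall>j<n. cell n N (\<tau> j) = cell n N j) \<and>
      cut_le m n (\<lambda>z. (f \<circ> map_prod \<sigma> \<tau>) z - cell_avg m n N' (f \<circ> map_prod \<sigma> \<tau>) z) \<epsilon>))"
    for N N' :: nat and \<epsilon> :: real
  have "\<exists>N'. good N N' (1 / real (Suc s))" for N s
    unfolding good_def by (rule sorted_regularity) simp
  then obtain R where R: "\<And>N s. good N (R N s) (1 / real (Suc s))" by metis
  define L where "L = rec_nat (R 0 0) (\<lambda>s N. R N (Suc s))"
  \<comment> \<open>\<open>L' s\<close> is the level preceding \<open>L s\<close>. Before the first
    level it is 0, where all indices below the dimension form a single cell and sorting is
    unrestricted.\<close>
  define L' where "L' s = (case s of 0 \<Rightarrow> 0 | Suc s \<Rightarrow> L s)" for s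
  have L: "good (L' s) (L s) (1 / real (Suc s))" for s
    using R by (cases s) (simp_all add: L_def L'_def del: of_nat_Suc)
  have "L s < L (Suc s)" for s
    using L[of "Suc s"] by (simp add: good_def L'_def)
  then have mono: "strict_mono L" by (rule strict_monoI_Suc)
  have "\<exists>\<sigma> \<tau>. \<sigma> permutes {..<m} \<and> \<tau> permutes {..<n} \<and>
       (\<forall>s<t. 2 ^ L s \<le> m \<longrightarrow> 2 ^ L s \<le> n \<longrightarrow>
         cut_le m n (\<lambda>z. (f \<circ> map_prod \<sigma> \<tau>) z - cell_avg m n (L s) (f \<circ> map_prod \<sigma> \<tau>) z)
           (1 / real (Suc s)))"
    if f: "\<forall>z\<in>{..<m} \<times> {..<n}. 0 \<le> f z \<and> f z \<le> 1" for m n f t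
  proof (induction t)
    case 0
    show ?case by (rule exI[of _ id], rule exI[of _ id], intro conjI permutes_id) simp
  next
    case (Suc t)
    then obtain \<sigma> \<tau> where \<sigma>: "\<sigma> permutes {..<m}" and \<tau>: "\<tau> permutes {..<n}"
      and *: "\<And>s. s < t \<Longrightarrow> 2 ^ L s \<le> m \<Longrightarrow> 2 ^ L s \<le> n \<Longrightarrow>
         cut_le m n (\<lambda>z. (f \<circ> map_prod \<sigma> \<tau>) z - cell_avg m n (L s) (f \<circ> map_prod \<sigma> \<tau>) z)
           (1 / real (Suc s))"
      by blast
    let ?f = "f \<circ> map_prod \<sigma> \<tau>"
    show ?case
    proof (cases "2 ^ L t \<le> m \<and> 2 ^ L t \<le> n")
      case False
      show ?thesis
      proof (rule exI[of _ \<sigma>], rule exI[of _ \<tau>], intro conjI allI impI \<sigma> \<tau>)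
        fix s assume "s < Suc t" "2 ^ L s \<le> m" "2 ^ L s \<le> n"
        with False have "s < t" by (cases "s = t") auto
        then show "cut_le m n (\<lambda>z. ?f z - cell_avg m n (L s) ?f z) (1 / real (Suc s))"
          using \<open>2 ^ L s \<le> m\<close> \<open>2 ^ L s \<le> n\<close> by (rule *)
      qed
    next
      case True
      have "\<forall>z\<in>{..<m} \<times> {..<n}. 0 \<le> ?f z \<and> ?f z \<le> 1"
      proof
        fix z assume "z \<in> {..<m} \<times> {..<n}"
        then have "map_prod \<sigma> \<tau> z \<in> {..<m} \<times> {..<n}"
          using bij_betwE[OF bij_betw_map_prod_permutes[OF \<sigma> \<tau>]] by blast
        from bspec[OF f this] show "0 \<le> ?f z \<and> ?f z \<le> 1" by simp
      qed
      with L[of t] True have "\<exists>\<sigma>' \<tau>'. \<sigma>' permutes {..<m} \<and> \<tau>' permutes {..<n} \<and>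
        (\<forall>i<m. cell m (L' t) (\<sigma>' i) = cell m (L' t) i) \<and>
        (\<forall>j<n. cell n (L' t) (\<tau>' j) = cell n (L' t) j) \<and>
        cut_le m n (\<lambda>z. (?f \<circ> map_prod \<sigma>' \<tau>') z - cell_avg m n (L t) (?f \<circ> map_prod \<sigma>' \<tau>') z)
          (1 / real (Suc t))"
        unfolding good_def by blast
      then obtain \<sigma>' \<tau>' where \<sigma>': "\<sigma>' permutes {..<m}" and \<tau>': "\<tau>' permutes {..<n}"
        and c: "\<And>i. i < m \<Longrightarrow> cell m (L' t) (\<sigma>' i) = cell m (L' t) i"
          "\<And>j. j < n \<Longrightarrow> cell n (L' t) (\<tau>' j) = cell n (L' t) j"
        and new: "cut_le m n (\<lambda>z. (?f \<circ> map_prod \<sigma>' \<tau>') z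
          - cell_avg m n (L t) (?f \<circ> map_prod \<sigma>' \<tau>') z) (1 / real (Suc t))"
        by blast
      \<comment> \<open>Composition on the right rearranges the matrix already obtained, whose cells
        are the ones to be preserved.\<close>
      have eq: "f \<circ> map_prod (\<sigma> \<circ> \<sigma>') (\<tau> \<circ> \<tau>') = ?f \<circ> map_prod \<sigma>' \<tau>'"
        by (auto simp: fun_eq_iff)
      show ?thesis
      proof (rule exI[of _ "\<sigma> \<circ> \<sigma>'"], rule exI[of _ "\<tau> \<circ> \<tau>'"], intro conjI allI impI)
        show "\<sigma> \<circ> \<sigma>' permutes {..<m}" by (rule permutes_compose[OF \<sigma>' \<sigma>])
        show "\<tau> \<circ> \<tau>' permutes {..<n}" by (rule permutes_compose[OF \<tau>' \<tau>])
        fix s assume s: "s < Suc t" "2 ^ L s \<le> m" "2 ^ L s \<le> n"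
        show "cut_le m n (\<lambda>z. (f \<circ> map_prod (\<sigma> \<circ> \<sigma>') (\<tau> \<circ> \<tau>')) z
            - cell_avg m n (L s) (f \<circ> map_prod (\<sigma> \<circ> \<sigma>') (\<tau> \<circ> \<tau>')) z) (1 / real (Suc s))"
        proof (cases "s = t")
          case True
          then show ?thesis using new by (simp only: eq)
        next
          case False
          then have st: "s < t" using s by simp
          then obtain t' where t': "t = Suc t'" by (cases t) auto
          have le: "L s \<le> L' t"
            using st mono by (simp add: t' L'_def strict_mono_less_eq)
          have coarse: "cell k (L s) a = cell k (L s) b" if "cell k (L' t) a = cell k (L' t) b" for k a b
            using cell_coarsen[OF le, of k a] cell_coarsen[OF le, of k b] that by simp
          show ?thesis
            unfolding eq
          proof (rule cut_le_cell_preserving[OF *[OF st s(2,3)] \<sigma>' \<tau>'])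
            show "cell m (L s) (\<sigma>' i) = cell m (L s) i" if "i < m" for i
              by (rule coarse[OF c(1)[OF that]])
            show "cell n (L s) (\<tau>' i) = cell n (L s) i" if "i < n" for i
              by (rule coarse[OF c(2)[OF that]])
          qed
        qed
      qed
    qed
  qed
  \<comment> \<open>The induction covers \<open>s < t\<close>; its instance at a successor yields
    \<open>s \<le> t\<close>.\<close>
  from this[where t = "Suc _"] show ?thesis
    unfolding less_Suc_eq_le using mono by blast
qed

subsection \<open>Compactness and completeness\<close>

text \<open>A countable product of unit intervals is compact by Tychonoff and metrizable, hence
  sequentially compact. This replaces an explicit diagonal argument.\<close>

lemma bounded_family_convergent_subseq:
  fixes f :: "nat \<Rightarrow> 'a::countable \<Rightarrow> real"
  assumes f: "\<And>k c. f k c \<in> {0..1}"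
  shows "\<exists>r l. strict_mono (r :: nat \<Rightarrow> nat) \<and> (\<forall>c. (\<lambda>k. f (r k) c) \<longlonglongrightarrow> l c)"
proof -
  have "compactin (product_topology (\<lambda>_. euclidean) UNIV) (PiE (UNIV :: 'a set) (\<lambda>_. {0..1::real}))"
    by (simp add: compactin_PiE)
  then have "compact (PiE (UNIV :: 'a set) (\<lambda>_. {0..1::real}))"
    by (simp add: euclidean_product_topology)
  then have "seq_compact (PiE (UNIV :: 'a set) (\<lambda>_. {0..1::real}))"
    by (simp add: compact_eq_seq_compact_metric)
  moreover have "\<forall>k. f k \<in> PiE UNIV (\<lambda>_. {0..1})"
    using f by auto
  ultimately obtain l r where r: "strict_mono (r :: nat \<Rightarrow> nat)" and l: "(f \<circ> r) \<longlonglongrightarrow> l"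
    by (rule seq_compactE)
  have "(\<lambda>k. f (r k) c) \<longlonglongrightarrow> l c" for c
  proof -
    have "isCont (\<lambda>g :: 'a \<Rightarrow> real. g c) l"
    proof -
      have "continuous_on UNIV (\<lambda>g :: 'a \<Rightarrow> real. g c)" by simp
      then show ?thesis unfolding continuous_on_eq_continuous_at[OF open_UNIV] by blast
    qed
    from isCont_tendsto_compose[OF this l] show ?thesis by (simp add: comp_def)
  qed
  with r show ?thesis by blast
qed

section \<open>Completeness in L1\<close>

lemma convergent_of_summable_diff:
  fixes a :: "nat \<Rightarrow> real"
  assumes "summable (\<lambda>j. \<bar>a (Suc j) - a j\<bar>)"
  shows "convergent a"
proof -
  have "summable (\<lambda>j. a (Suc j) - a j)"
    using assms by (rule summable_rabs_cancel)
  then have "(\<lambda>n. \<Sum>j<n. a (Suc j) - a j) \<longlonglongrightarrow> (\<Sum>j. a (Suc j) - a j)"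
    by (rule summable_LIMSEQ)
  then have "(\<lambda>n. (a n - a 0) + a 0) \<longlonglongrightarrow> (\<Sum>j. a (Suc j) - a j) + a 0"
    unfolding sum_lessThan_telescope by (intro tendsto_intros)
  then show ?thesis by (auto simp: convergent_def)
qed

text \<open>The Riesz-Fischer argument: along a sparse sequence the increments have summable L1
  norms, so the functions converge almost everywhere, and dominated convergence gives L1 convergence
  along it. Only approximation by arbitrarily late \<open>f t\<close> is concluded, because a single
  good level per error suffices later.\<close>

lemma L1_Cauchy_limit_point:
  fixes f :: "nat \<Rightarrow> 'a \<Rightarrow> real"
  assumes M: "finite_measure M" and meas[measurable]: "\<And>n. f n \<in> borel_measurable M"
    and f01: "\<And>n x. 0 \<le> f n x \<and> f n x \<le> 1"
    and Cauchy: "\<And>\<epsilon>. \<epsilon> > 0 \<Longrightarrow> \<exists>T. \<forall>s\<ge>T. \<forall>t\<ge>T. (\<integral>x. \<bar>f s x - f t x\<bar> \<partial>M) < \<epsilon>"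
  shows "\<exists>g. g \<in> borel_measurable M \<and> (\<forall>x. 0 \<le> g x \<and> g x \<le> 1) \<and>
     (\<forall>\<epsilon>>0. \<forall>T. \<exists>t\<ge>T. (\<integral>x. \<bar>f t x - g x\<bar> \<partial>M) < \<epsilon>)"
proof -
  interpret finite_measure M by (rule M)
  have int: "integrable M (\<lambda>x. \<bar>f s x - f t x\<bar>)" for s t
  proof (rule integrable_const_bound[where B = 1])
    show "AE x in M. norm \<bar>f s x - f t x\<bar> \<le> 1"
    proof (intro AE_I2)
      fix x show "norm \<bar>f s x - f t x\<bar> \<le> 1"
        using f01[of s x] f01[of t x] by (simp add: abs_le_iff)
    qed
  qed measurable
  have "\<exists>T. \<forall>s\<ge>T. \<forall>t\<ge>T. (\<integral>x. \<bar>f s x - f t x\<bar> \<partial>M) < (1/2) ^ j" for j :: nat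
    by (rule Cauchy) simp
  then obtain T where T: "\<And>j s t. s \<ge> T j \<Longrightarrow> t \<ge> T j \<Longrightarrow> (\<integral>x. \<bar>f s x - f t x\<bar> \<partial>M) < (1/2) ^ j"
    by metis
  \<comment> \<open>Summing the thresholds makes \<open>r\<close> monotone and at least
    \<open>T j\<close>; the added \<open>j\<close> makes it unbounded.\<close>
  define r where "r j = (\<Sum>i\<le>j. T i) + j" for j
  have rT: "T j \<le> r j" for j
    unfolding r_def by (rule trans_le_add1) (rule member_le_sum; simp)
  have rS: "r j \<le> r (Suc j)" for j by (simp add: r_def)
  have rge: "j \<le> r j" for j by (simp add: r_def)
  define h where "h j x = \<bar>f (r (Suc j)) x - f (r j) x\<bar>" for j x
  have [measurable]: "h j \<in> borel_measurable M" for j unfolding h_def by measurable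
  have hint: "(\<integral>\<^sup>+x. ennreal (h j x) \<partial>M) \<le> ennreal ((1/2) ^ j)" for j
  proof -
    have "(\<integral>\<^sup>+x. ennreal (h j x) \<partial>M) = ennreal (\<integral>x. h j x \<partial>M)"
      unfolding h_def by (rule nn_integral_eq_integral[OF int]) simp
    also have "\<dots> \<le> ennreal ((1/2) ^ j)"
      unfolding h_def
      using T[of j "r (Suc j)" "r j"] rT[of j] rS[of j] by (intro ennreal_leI) simp
    finally show ?thesis .
  qed
  have "(\<integral>\<^sup>+x. (\<Sum>j. ennreal (h j x)) \<partial>M) = (\<Sum>j. \<integral>\<^sup>+x. ennreal (h j x) \<partial>M)"
    by (rule nn_integral_suminf) measurable
  also have "\<dots> \<le> (\<Sum>j. ennreal ((1/2) ^ j))"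
    by (intro suminf_le hint) auto
  also have "\<dots> = ennreal (\<Sum>j. (1/2) ^ j)"
    by (rule suminf_ennreal2) (auto intro: summable_geometric)
  also have "\<dots> < \<infinity>" by simp
  finally have "AE x in M. (\<Sum>j. ennreal (h j x)) \<noteq> \<infinity>"
    by (intro nn_integral_PInf_AE) auto
  then have conv: "AE x in M. convergent (\<lambda>j. f (r j) x)"
  proof eventually_elim
    case (elim x)
    then have "summable (\<lambda>j. h j x)"
      by (intro summable_suminf_not_top) (auto simp: h_def)
    then show ?case unfolding h_def by (rule convergent_of_summable_diff)
  qed
  \<comment> \<open>Clamping gives a value in the unit interval also on the null set where the
    sequence diverges.\<close>
  define g where "g x = max 0 (min 1 (lim (\<lambda>j. f (r j) x)))" for x
  have [measurable]: "g \<in> borel_measurable M" unfolding g_def by measurable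
  have g01: "0 \<le> g x \<and> g x \<le> 1" for x by (simp add: g_def)
  have lim: "AE x in M. (\<lambda>j. \<bar>f (r j) x - g x\<bar>) \<longlonglongrightarrow> 0"
    using conv
  proof eventually_elim
    case (elim x)
    then have L: "(\<lambda>j. f (r j) x) \<longlonglongrightarrow> lim (\<lambda>j. f (r j) x)"
      by (simp add: convergent_LIMSEQ_iff)
    have "0 \<le> lim (\<lambda>j. f (r j) x)" "lim (\<lambda>j. f (r j) x) \<le> 1"
      using f01 by (intro LIMSEQ_le_const[OF L] LIMSEQ_le_const2[OF L]; blast)+
    then have "g x = lim (\<lambda>j. f (r j) x)" by (simp add: g_def)
    with L have "(\<lambda>j. f (r j) x - g x) \<longlonglongrightarrow> 0" by (simp add: LIM_zero)
    then show ?case by (rule tendsto_rabs_zero)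
  qed
  have "(\<lambda>j. \<integral>x. \<bar>f (r j) x - g x\<bar> \<partial>M) \<longlonglongrightarrow> (\<integral>x. 0 \<partial>M)"
  proof (rule integral_dominated_convergence[where w = "\<lambda>_. 1"])
    show "AE x in M. norm \<bar>f (r j) x - g x\<bar> \<le> 1" for j
    proof (intro AE_I2)
      fix x show "norm \<bar>f (r j) x - g x\<bar> \<le> 1"
        using f01[of "r j" x] g01[of x] by (simp add: abs_le_iff)
    qed
  qed (use lim in auto)
  then have L0: "(\<lambda>j. \<integral>x. \<bar>f (r j) x - g x\<bar> \<partial>M) \<longlonglongrightarrow> 0" by simp
  have "\<exists>t\<ge>T. (\<integral>x. \<bar>f t x - g x\<bar> \<partial>M) < \<epsilon>" if "\<epsilon> > 0" for \<epsilon> T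
  proof -
    have "eventually (\<lambda>j. (\<integral>x. \<bar>f (r j) x - g x\<bar> \<partial>M) < \<epsilon>) sequentially"
      using order_tendstoD(2)[OF L0 that] .
    then obtain J where J: "\<And>j. j \<ge> J \<Longrightarrow> (\<integral>x. \<bar>f (r j) x - g x\<bar> \<partial>M) < \<epsilon>"
      by (auto simp: eventually_sequentially)
    show ?thesis
      using J[of "max J T"] rge[of "max J T"] by (intro exI[of _ "r (max J T)"]) auto
  qed
  with g01 show ?thesis by (intro exI[of _ g]) auto
qed

subsection \<open>Step graphons and discretization\<close>

text \<open>Defined on the whole plane: negative coordinates get index 0, and coordinate 1 gets the
  index \<open>2 ^ N\<close> just outside the grid, where the block functions to be integrated
  vanish.\<close>

definition step_graphon :: "nat \<Rightarrow> (nat \<times> nat \<Rightarrow> real) \<Rightarrow> real \<Rightarrow> real \<Rightarrow> real" where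
  "step_graphon N D x y = D (nat \<lfloor>2 ^ N * x\<rfloor>, nat \<lfloor>2 ^ N * y\<rfloor>)"

definition unit_square :: "(real \<times> real) set" where
  "unit_square = {0..1} \<times> {0..1}"

lemma borel_measurable_step_graphon [measurable]:
  "(\<lambda>z. step_graphon N D (fst z) (snd z)) \<in> borel_measurable (borel :: (real \<times> real) measure)"
proof -
  have f: "(\<lambda>z::real \<times> real. nat \<lfloor>2 ^ N * fst z\<rfloor>) \<in> measurable borel (count_space UNIV)"
  proof -
    have [measurable]: "(\<lambda>z::real \<times> real. 2 ^ N * fst z) \<in> borel_measurable borel"
      by (intro borel_measurable_continuous_onI continuous_intros)
    show ?thesis by measurable
  qed
  have s: "(\<lambda>z::real \<times> real. nat \<lfloor>2 ^ N * snd z\<rfloor>) \<in> measurable borel (count_space UNIV)"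
  proof -
    have [measurable]: "(\<lambda>z::real \<times> real. 2 ^ N * snd z) \<in> borel_measurable borel"
      by (intro borel_measurable_continuous_onI continuous_intros)
    show ?thesis by measurable
  qed
  have "(\<lambda>z::real \<times> real. D (a, nat \<lfloor>2 ^ N * snd z\<rfloor>)) \<in> borel_measurable borel" for a
    by (rule measurable_compose[OF s]) simp
  from measurable_compose_countable[OF this f] show ?thesis
    by (simp add: step_graphon_def)
qed

lemma measure_rectangle:
  fixes a b c d :: real
  assumes "a \<le> b" "c \<le> d"
  shows "measure lborel ({a..b} \<times> {c..d}) = (b - a) * (d - c)"
    and "emeasure lborel ({a..b} \<times> {c..d}) < \<infinity>"
    and "{a..b} \<times> {c..d} \<in> sets lborel"
proof -
  have *: "{a..b} \<times> {c..d} = cbox (a, c) (b, d)" by (simp add: cbox_Pair_eq)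
  show "measure lborel ({a..b} \<times> {c..d}) = (b - a) * (d - c)"
    unfolding * content_Pair using assms by simp
  show "emeasure lborel ({a..b} \<times> {c..d}) < \<infinity>"
    unfolding * by (rule emeasure_lborel_cbox_finite)
  show "{a..b} \<times> {c..d} \<in> sets lborel"
    unfolding * by simp
qed

lemma unit_square_measure:
  "unit_square \<in> sets lborel" "emeasure lborel unit_square < \<infinity>"
  unfolding unit_square_def using measure_rectangle[of 0 1 0 1] by auto

lemma integrable_bounded_on:
  fixes h :: "real \<times> real \<Rightarrow> real"
  assumes "A \<in> sets lborel" "emeasure lborel A < \<infinity>" "h \<in> borel_measurable borel" "\<And>z. \<bar>h z\<bar> \<le> B"
  shows "integrable lborel (\<lambda>z. indicator A z * h z)"
  by (rule integrableI_bounded_set[where A = A and B = B])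
     (use assms in \<open>auto simp: abs_mult indicator_def intro!: AE_I2 borel_measurable_times\<close>)

text \<open>An upper bound suffices, so closed boxes may overlap along their edges: by nonnegativity
  their sum dominates the step function at every point, and no null sets need to be removed.\<close>

lemma integral_step_le:
  assumes "\<And>z. z \<notin> {..<2 ^ N} \<times> {..<2 ^ N} \<Longrightarrow> F z = 0" "\<And>z. 0 \<le> F z"
  shows "(\<integral>z. indicator unit_square z * step_graphon N F (fst z) (snd z) \<partial>lborel) \<le>
    (\<Sum>z\<in>{..<2 ^ N} \<times> {..<2 ^ N}. F z) / 4 ^ N"
proof -
  let ?X = "{..<2 ^ N} \<times> {..<2 ^ N} :: (nat \<times> nat) set"
  define Q :: "nat \<times> nat \<Rightarrow> (real \<times> real) set" where
    "Q z = {real (fst z) / 2 ^ N .. real (Suc (fst z)) / 2 ^ N} \<times>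
         {real (snd z) / 2 ^ N .. real (Suc (snd z)) / 2 ^ N}" for z
  have le: "real i / 2 ^ N \<le> real (Suc i) / 2 ^ N" for i by (simp add: divide_right_mono)
  have mQ: "measure lborel (Q z) = 1 / 4 ^ N" for z
  proof -
    have "measure lborel (Q z) = (1 / 2 ^ N) * (1 / 2 ^ N)"
      unfolding Q_def measure_rectangle(1)[OF le le] by (simp add: field_simps)
    also have "\<dots> = 1 / 4 ^ N" by (simp add: power_mult_distrib[symmetric])
    finally show ?thesis .
  qed
  have Qs: "Q z \<in> sets lborel" "emeasure lborel (Q z) < \<infinity>" for z
    unfolding Q_def by (rule measure_rectangle[OF le le])+
  have int: "integrable lborel (\<lambda>p. F z * indicator (Q z) p)" for z
    using Qs[of z] by (intro integrable_mult_right integrable_real_indicator) auto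
  have pt: "indicator unit_square p * step_graphon N F (fst p) (snd p) \<le>
     (\<Sum>z\<in>?X. F z * indicator (Q z) p)" for p
  proof (cases "p \<in> unit_square \<and> (nat \<lfloor>2 ^ N * fst p\<rfloor>, nat \<lfloor>2 ^ N * snd p\<rfloor>) \<in> ?X")
    case True
    let ?z = "(nat \<lfloor>2 ^ N * fst p\<rfloor>, nat \<lfloor>2 ^ N * snd p\<rfloor>)"
    have fl: "real (nat \<lfloor>2 ^ N * x\<rfloor>) / 2 ^ N \<le> x \<and> x \<le> real (Suc (nat \<lfloor>2 ^ N * x\<rfloor>)) / 2 ^ N"
      if "0 \<le> x" for x :: real
    proof -
      have "0 \<le> 2 ^ N * x" using that by simp
      then have "real (nat \<lfloor>2 ^ N * x\<rfloor>) = real_of_int \<lfloor>2 ^ N * x\<rfloor>" by simp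
      moreover have "real_of_int \<lfloor>2 ^ N * x\<rfloor> \<le> 2 ^ N * x" "2 ^ N * x \<le> real_of_int \<lfloor>2 ^ N * x\<rfloor> + 1"
        by linarith+
      ultimately show ?thesis by (simp add: field_simps)
    qed
    have "p \<in> Q ?z"
      unfolding Q_def using fl[of "fst p"] fl[of "snd p"] True
      by (simp add: unit_square_def mem_Times_iff)
    then have "indicator unit_square p * step_graphon N F (fst p) (snd p) = F ?z * indicator (Q ?z) p"
      using True by (simp add: step_graphon_def)
    also have "\<dots> \<le> (\<Sum>z\<in>?X. F z * indicator (Q z) p)"
      by (rule member_le_sum) (use True assms(2) in auto)
    finally show ?thesis .
  next
    case False
    then have "indicator unit_square p * step_graphon N F (fst p) (snd p) = 0"
      using assms(1) by (auto simp: step_graphon_def)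
    moreover have "0 \<le> (\<Sum>z\<in>?X. F z * indicator (Q z) p)"
      using assms(2) by (intro sum_nonneg mult_nonneg_nonneg) auto
    ultimately show ?thesis by linarith
  qed
  have "(\<integral>z. indicator unit_square z * step_graphon N F (fst z) (snd z) \<partial>lborel) \<le>
      (\<integral>p. (\<Sum>z\<in>?X. F z * indicator (Q z) p) \<partial>lborel)"
  proof (rule integral_mono')
    show "integrable lborel (\<lambda>p. \<Sum>z\<in>?X. F z * indicator (Q z) p)"
      by (rule Bochner_Integration.integrable_sum) (rule int)
    show "0 \<le> (\<Sum>z\<in>?X. F z * indicator (Q z) p)" for p
      using assms(2) by (intro sum_nonneg mult_nonneg_nonneg) auto
  qed (rule pt)
  also have "\<dots> = (\<Sum>z\<in>?X. \<integral>p. F z * indicator (Q z) p \<partial>lborel)"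
    by (rule Bochner_Integration.integral_sum) (rule int)
  also have "\<dots> = (\<Sum>z\<in>?X. F z * (1 / 4 ^ N))"
    by (intro sum.cong refl) (simp add: mQ)
  also have "\<dots> = (\<Sum>z\<in>?X. F z) / 4 ^ N"
    by (simp add: sum_divide_distrib)
  finally show ?thesis .
qed

text \<open>The rows whose interval is not contained in a single dyadic interval: at most the last row of
  each cell.\<close>

lemma card_incomplete_cells:
  assumes "m > 0"
  shows "card {i. i < m \<and> \<not> Suc i * 2 ^ N \<le> Suc (cell m N i) * m} \<le> 2 ^ N"
proof -
  let ?B = "{i. i < m \<and> \<not> Suc i * 2 ^ N \<le> Suc (cell m N i) * m}"
  have upper: "i * 2 ^ N < Suc (cell m N i) * m" for i
    using dividend_less_div_times[OF assms, of "i * 2 ^ N"] by (simp add: cell_def)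
  have *: False if "i \<in> ?B" "i' \<in> ?B" "cell m N i = cell m N i'" "i < i'" for i i'
  proof -
    have "Suc i * 2 ^ N \<le> i' * 2 ^ N" using that(4) by (intro mult_le_mono1) simp
    also have "\<dots> < Suc (cell m N i) * m" using upper[of i'] that(3) by simp
    finally show False using that(1) by simp
  qed
  have "inj_on (cell m N) ?B"
  proof (intro inj_onI)
    fix i i' assume B: "i \<in> ?B" "i' \<in> ?B" "cell m N i = cell m N i'"
    then have "\<not> i < i'" "\<not> i' < i" using *[of i i'] *[of i' i] B(3)[symmetric] by blast+
    then show "i = i'" by simp
  qed
  then have "card ?B = card (cell m N ` ?B)" by (simp add: card_image)
  also have "\<dots> \<le> card {..<(2::nat) ^ N}"
    by (intro card_mono) (auto simp: cell_less)
  finally show ?thesis by simp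
qed

text \<open>The left endpoint of the row interval lies in the dyadic interval by definition of
  \<open>cell\<close>; the inequality with \<open>Suc\<close> says that the right endpoint does not
  pass its end.\<close>

lemma floor_in_cell:
  assumes "m > 0" "Suc i * 2 ^ N \<le> Suc (cell m N i) * m"
    and "real i / real m < x" "x < real (Suc i) / real m"
  shows "nat \<lfloor>2 ^ N * x\<rfloor> = cell m N i"
proof -
  have "real (cell m N i * m) \<le> real (i * 2 ^ N)"
    unfolding of_nat_le_iff cell_def by (rule div_times_less_eq_dividend)
  then have lo: "real (cell m N i) * real m \<le> real i * 2 ^ N" by simp
  have "real (Suc i * 2 ^ N) \<le> real (Suc (cell m N i) * m)"
    unfolding of_nat_le_iff by (rule assms(2))
  then have hi: "real (Suc i) * 2 ^ N \<le> real (Suc (cell m N i)) * real m"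
    by (simp only: of_nat_mult of_nat_power of_nat_numeral)
  have x: "real i < x * real m" "x * real m < real (Suc i)"
    using assms(1,3,4) by (simp_all add: field_simps)
  have "real (cell m N i) * real m < (2 ^ N * x) * real m"
  proof -
    have "real i * 2 ^ N < (x * real m) * 2 ^ N" using x(1) by simp
    with lo have "real (cell m N i) * real m < (x * real m) * 2 ^ N" by linarith
    then show ?thesis by (simp only: mult_ac)
  qed
  then have 1: "real (cell m N i) < 2 ^ N * x" using assms(1) by simp
  have "(2 ^ N * x) * real m < real (Suc (cell m N i)) * real m"
  proof -
    have "(x * real m) * 2 ^ N < real (Suc i) * 2 ^ N" using x(2) by (rule mult_strict_right_mono) simp
    with hi have "(x * real m) * 2 ^ N < real (Suc (cell m N i)) * real m" by linarith
    then show ?thesis by (simp only: mult_ac)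
  qed
  then have 2: "2 ^ N * x < real (Suc (cell m N i))" using assms(1) by simp
  have "\<lfloor>2 ^ N * x\<rfloor> = int (cell m N i)"
    using 1 2 by (intro floor_unique) auto
  then show ?thesis by simp
qed

text \<open>The open box of the entry lies in one dyadic block. The floors may jump on the boundary
  of the closed box, but that is a null set.\<close>

lemma discretize_step_graphon:
  assumes "m > 0" "n > 0" "Suc i * 2 ^ N \<le> Suc (cell m N i) * m" "Suc j * 2 ^ N \<le> Suc (cell n N j) * n"
  shows "discretize m n (step_graphon N D) i j = D (cell m N i, cell n N j)"
proof -
  let ?R = "{real i / real m .. real (Suc i) / real m} \<times> {real j / real n .. real (Suc j) / real n}"
  let ?lo = "(real i / real m, real j / real n)" and ?hi = "(real (Suc i) / real m, real (Suc j) / real n)"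
  have le: "real i / real m \<le> real (Suc i) / real m" "real j / real n \<le> real (Suc j) / real n"
    by (simp_all add: divide_right_mono)
  have R: "?R = cbox ?lo ?hi" by (simp add: cbox_Pair_eq)
  have mR: "measure lborel ?R = 1 / (real m * real n)"
    unfolding measure_rectangle(1)[OF le] using assms(1,2) by (simp add: field_simps)
  have "cbox ?lo ?hi - box ?lo ?hi \<in> null_sets lborel"
    by (auto simp: null_sets_def emeasure_Diff emeasure_lborel_cbox_eq emeasure_lborel_box_eq box_subset_cbox)
  then have "AE z in lborel. z \<notin> cbox ?lo ?hi - box ?lo ?hi"
    by (rule AE_not_in)
  then have "AE z in lborel. indicator ?R z *\<^sub>R step_graphon N D (fst z) (snd z) =
      indicator ?R z *\<^sub>R D (cell m N i, cell n N j)"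
  proof eventually_elim
    case (elim z)
    show ?case
    proof (cases "z \<in> ?R")
      case True
      with elim have "z \<in> box ?lo ?hi" unfolding R by blast
      then have "real i / real m < fst z" "fst z < real (Suc i) / real m"
         "real j / real n < snd z" "snd z < real (Suc j) / real n"
        by (auto simp: mem_box Basis_prod_def inner_prod_def)
      then show ?thesis
        using floor_in_cell[OF assms(1,3), of "fst z"] floor_in_cell[OF assms(2,4), of "snd z"]
        by (simp add: step_graphon_def)
    qed simp
  qed
  then have "(LINT z : ?R | lborel. step_graphon N D (fst z) (snd z)) =
      (\<integral>z. indicator ?R z *\<^sub>R D (cell m N i, cell n N j) \<partial>lborel)"
    unfolding set_lebesgue_integral_def
    using measure_rectangle(3)[OF le]
    by (intro integral_cong_AE) (auto intro!: borel_measurable_scaleR borel_measurable_indicator)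
  also have "\<dots> = D (cell m N i, cell n N j) / (real m * real n)"
    using measure_rectangle(2,3)[OF le] mR by (simp add: less_top)
  finally show ?thesis
    unfolding discretize_def using assms(1,2) by simp
qed

text \<open>The constant 2 accounts for the shared endpoints of the closed intervals.\<close>

lemma sum_indicator_intervals_le:
  fixes x :: real
  assumes "m > 0"
  shows "(\<Sum>i<m. indicator {real i / real m .. real (Suc i) / real m} x) \<le>
     (2 * indicator {0..1} x :: real)"
proof (cases "x \<in> {0..1}")
  case True
  let ?I = "\<lambda>i. {real i / real m .. real (Suc i) / real m}"
  have "{i \<in> {..<m}. x \<in> ?I i} \<subseteq> {nat \<lfloor>x * m\<rfloor>, nat \<lfloor>x * m\<rfloor> - 1}"
  proof
    fix i assume "i \<in> {i \<in> {..<m}. x \<in> ?I i}"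
    then have "real i \<le> x * real m" "x * real m \<le> real (Suc i)"
      using assms by (simp_all add: field_simps)
    then have "\<lfloor>x * m\<rfloor> = int i \<or> \<lfloor>x * m\<rfloor> = int i + 1" by linarith
    then show "i \<in> {nat \<lfloor>x * m\<rfloor>, nat \<lfloor>x * m\<rfloor> - 1}" by auto
  qed
  then have "card {i \<in> {..<m}. x \<in> ?I i} \<le> card {nat \<lfloor>x * m\<rfloor>, nat \<lfloor>x * m\<rfloor> - 1}"
    by (rule card_mono[rotated]) simp
  also have "\<dots> \<le> 2" by (simp add: card_insert_if)
  finally have "real (card {i \<in> {..<m}. x \<in> ?I i}) \<le> 2" by simp
  moreover have "(\<Sum>i<m. indicator (?I i) x :: real) = real (card {i \<in> {..<m}. x \<in> ?I i})"
    by (simp add: indicator_def Int_def del: atLeastAtMost_iff)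
  ultimately show ?thesis using True by simp
next
  case False
  have out: "x \<notin> {real i / real m .. real (Suc i) / real m}" if "i < m" for i
  proof
    assume x: "x \<in> {real i / real m .. real (Suc i) / real m}"
    have "0 \<le> real i / real m" by simp
    moreover have "real (Suc i) / real m \<le> 1" using that assms by (simp add: field_simps)
    moreover have "real i / real m \<le> x" "x \<le> real (Suc i) / real m"
      using x by (simp_all only: atLeastAtMost_iff)
    ultimately have "0 \<le> x" "x \<le> 1" by linarith+
    with False show False by simp
  qed
  have "(\<Sum>i<m. indicator {real i / real m .. real (Suc i) / real m} x) = (0::real)"
    by (intro sum.neutral ballI) (simp add: out del: atLeastAtMost_iff of_nat_Suc)
  then show ?thesis by simp
qed

text \<open>Each entry is bounded by the integral of the absolute difference over its box. Pointwise
  at most two row intervals and two column intervals meet a point, which gives the factor 4.\<close>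

lemma discretize_L1_le:
  fixes U V :: "real \<Rightarrow> real \<Rightarrow> real"
  assumes mn: "m > 0" "n > 0"
    and U: "(\<lambda>z. U (fst z) (snd z)) \<in> borel_measurable borel" "\<And>x y. 0 \<le> U x y \<and> U x y \<le> 1"
    and V: "(\<lambda>z. V (fst z) (snd z)) \<in> borel_measurable borel" "\<And>x y. 0 \<le> V x y \<and> V x y \<le> 1"
  shows "(\<Sum>z\<in>{..<m} \<times> {..<n}. \<bar>discretize m n U (fst z) (snd z) - discretize m n V (fst z) (snd z)\<bar>) \<le>
    4 * (\<integral>z. indicator unit_square z * \<bar>U (fst z) (snd z) - V (fst z) (snd z)\<bar> \<partial>lborel)
      * (real m * real n)"
proof -
  let ?X = "{..<m} \<times> {..<n}"
  define R :: "nat \<times> nat \<Rightarrow> (real \<times> real) set" where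
    "R z = {real (fst z) / real m .. real (Suc (fst z)) / real m} \<times>
        {real (snd z) / real n .. real (Suc (snd z)) / real n}" for z
  define u v where "u = (\<lambda>z. U (fst z) (snd z))" and "v = (\<lambda>z. V (fst z) (snd z))"
  have le: "real i / real k \<le> real (Suc i) / real k" for i k by (simp add: divide_right_mono)
  have R: "R z \<in> sets lborel" "emeasure lborel (R z) < \<infinity>" for z
    unfolding R_def by (rule measure_rectangle[OF le le])+
  have [measurable]: "u \<in> borel_measurable borel" "v \<in> borel_measurable borel"
    using U V by (simp_all add: u_def v_def)
  have d1: "\<bar>u z - v z\<bar> \<le> 1" for z
    using U(2)[of "fst z" "snd z"] V(2)[of "fst z" "snd z"] by (simp add: u_def v_def abs_le_iff)
  have iu: "integrable lborel (\<lambda>p. indicator (R z) p * u p)" for z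
    by (rule integrable_bounded_on[OF R, where B = 1]) (use U in \<open>auto simp: u_def\<close>)
  have iv: "integrable lborel (\<lambda>p. indicator (R z) p * v p)" for z
    by (rule integrable_bounded_on[OF R, where B = 1]) (use V in \<open>auto simp: v_def\<close>)
  have id: "integrable lborel (\<lambda>p. indicator (R z) p * \<bar>u p - v p\<bar>)" for z
    by (rule integrable_bounded_on[OF R, where B = 1]) (use d1 in auto)
  have isq: "integrable lborel (\<lambda>p. indicator unit_square p * \<bar>u p - v p\<bar>)"
    by (rule integrable_bounded_on[OF unit_square_measure, where B = 1]) (use d1 in auto)
  have disc: "discretize m n U (fst z) (snd z) = real m * real n * (\<integral>p. indicator (R z) p * u p \<partial>lborel)"
     "discretize m n V (fst z) (snd z) = real m * real n * (\<integral>p. indicator (R z) p * v p \<partial>lborel)" for z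
    by (simp_all add: discretize_def set_lebesgue_integral_def R_def u_def v_def)
  have one: "\<bar>discretize m n U (fst z) (snd z) - discretize m n V (fst z) (snd z)\<bar> \<le>
      real m * real n * (\<integral>p. indicator (R z) p * \<bar>u p - v p\<bar> \<partial>lborel)" for z
  proof -
    have "\<bar>(\<integral>p. indicator (R z) p * u p \<partial>lborel) - (\<integral>p. indicator (R z) p * v p \<partial>lborel)\<bar>
        = \<bar>\<integral>p. indicator (R z) p * u p - indicator (R z) p * v p \<partial>lborel\<bar>"
      by (simp add: Bochner_Integration.integral_diff[OF iu iv])
    also have "\<dots> \<le> (\<integral>p. \<bar>indicator (R z) p * u p - indicator (R z) p * v p\<bar> \<partial>lborel)"
      by (rule integral_abs_bound)
    also have "\<dots> = (\<integral>p. indicator (R z) p * \<bar>u p - v p\<bar> \<partial>lborel)"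
      by (rule Bochner_Integration.integral_cong) (auto simp: indicator_def)
    finally have "real m * real n * \<bar>(\<integral>p. indicator (R z) p * u p \<partial>lborel)
        - (\<integral>p. indicator (R z) p * v p \<partial>lborel)\<bar> \<le>
        real m * real n * (\<integral>p. indicator (R z) p * \<bar>u p - v p\<bar> \<partial>lborel)"
      by (rule mult_left_mono) simp
    then show ?thesis unfolding disc right_diff_distrib[symmetric] abs_mult by simp
  qed
  have pt: "(\<Sum>z\<in>?X. indicator (R z) p * \<bar>u p - v p\<bar>) \<le> 4 * (indicator unit_square p * \<bar>u p - v p\<bar>)" for p
  proof -
    have "(\<Sum>z\<in>?X. indicator (R z) p :: real) =
      (\<Sum>i<m. indicator {real i / real m .. real (Suc i) / real m} (fst p)) *
      (\<Sum>j<n. indicator {real j / real n .. real (Suc j) / real n} (snd p))"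
      unfolding sum_product sum.cartesian_product
      by (rule sum.cong) (auto simp: R_def indicator_def mem_Times_iff)
    also have "\<dots> \<le> (2 * indicator {0..1} (fst p)) * (2 * indicator {0..1} (snd p))"
      by (intro mult_mono sum_indicator_intervals_le mn sum_nonneg) auto
    also have "\<dots> = 4 * indicator unit_square p"
      by (auto simp: unit_square_def indicator_def mem_Times_iff)
    finally have "(\<Sum>z\<in>?X. indicator (R z) p) * \<bar>u p - v p\<bar> \<le> 4 * indicator unit_square p * \<bar>u p - v p\<bar>"
      by (rule mult_right_mono) simp
    then show ?thesis by (simp add: sum_distrib_right mult.assoc)
  qed
  have "(\<Sum>z\<in>?X. \<bar>discretize m n U (fst z) (snd z) - discretize m n V (fst z) (snd z)\<bar>) \<le>
      (\<Sum>z\<in>?X. real m * real n * (\<integral>p. indicator (R z) p * \<bar>u p - v p\<bar> \<partial>lborel))"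
    by (intro sum_mono one)
  also have "\<dots> = real m * real n * (\<integral>p. (\<Sum>z\<in>?X. indicator (R z) p * \<bar>u p - v p\<bar>) \<partial>lborel)"
    by (subst Bochner_Integration.integral_sum[OF id]) (simp add: sum_distrib_left)
  also have "\<dots> \<le> real m * real n * (\<integral>p. 4 * (indicator unit_square p * \<bar>u p - v p\<bar>) \<partial>lborel)"
    by (intro mult_left_mono integral_mono pt integrable_mult_right isq Bochner_Integration.integrable_sum id) auto
  also have "\<dots> = 4 * (\<integral>p. indicator unit_square p * \<bar>u p - v p\<bar> \<partial>lborel) * (real m * real n)"
    by simp
  finally show ?thesis by (simp add: u_def v_def)
qed

lemma discretize_bounds:
  assumes mn: "m > 0" "n > 0"
    and U: "(\<lambda>z. U (fst z) (snd z)) \<in> borel_measurable borel" "\<And>x y. 0 \<le> U x y \<and> U x y \<le> 1"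
  shows "0 \<le> discretize m n U i j" "discretize m n U i j \<le> 1"
proof -
  let ?R = "{real i / real m .. real (Suc i) / real m} \<times> {real j / real n .. real (Suc j) / real n}"
  have le: "real i / real m \<le> real (Suc i) / real m" "real j / real n \<le> real (Suc j) / real n"
    by (simp_all add: divide_right_mono)
  note R = measure_rectangle[OF le]
  have "0 \<le> (\<integral>p. indicator ?R p * U (fst p) (snd p) \<partial>lborel)"
    using U(2) by (intro Bochner_Integration.integral_nonneg) simp
  then show "0 \<le> discretize m n U i j"
    by (simp add: discretize_def set_lebesgue_integral_def)
  have "(\<integral>p. indicator ?R p * U (fst p) (snd p) \<partial>lborel) \<le> (\<integral>p. indicator ?R p \<partial>lborel)"
  proof (rule integral_mono)
    show "integrable lborel (\<lambda>p. indicator ?R p * U (fst p) (snd p))"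
      by (rule integrable_bounded_on[OF R(3,2) U(1), where B = 1]) (use U(2) in auto)
    show "integrable lborel (\<lambda>p. indicator ?R p :: real)"
      using R by (intro integrable_real_indicator) auto
    show "indicator ?R p * U (fst p) (snd p) \<le> indicator ?R p" for p
      using U(2) by (simp add: indicator_def)
  qed
  also have "\<dots> = measure lborel ?R" by simp
  also have "\<dots> = 1 / (real m * real n)"
    unfolding R(1) using mn by (simp add: field_simps)
  finally have "real m * real n * (\<integral>p. indicator ?R p * U (fst p) (snd p) \<partial>lborel) \<le> 1"
    using mn by (simp add: field_simps)
  then show "discretize m n U i j \<le> 1"
    by (simp add: discretize_def set_lebesgue_integral_def)
qed

subsection \<open>Dyadic martingales\<close>

definition dyadic_grid :: "nat \<Rightarrow> (nat \<times> nat) set" where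
  "dyadic_grid N = {..<2 ^ N} \<times> {..<2 ^ N}"

definition coarsen :: "nat \<Rightarrow> nat \<times> nat \<Rightarrow> nat \<times> nat" where
  "coarsen u z = (fst z div 2 ^ u, snd z div 2 ^ u)"

lemma finite_dyadic_grid [simp]: "finite (dyadic_grid N)"
  by (simp add: dyadic_grid_def)

lemma card_dyadic_grid: "card (dyadic_grid N) = 4 ^ N"
  by (simp add: dyadic_grid_def card_cartesian_product power_mult_distrib[symmetric])

lemma coarsen_in_grid_iff:
  assumes "s \<le> t"
  shows "coarsen (t - s) z \<in> dyadic_grid s \<longleftrightarrow> z \<in> dyadic_grid t"
proof -
  have "(2::nat) ^ t = 2 ^ s * 2 ^ (t - s)" using assms by (simp flip: power_add)
  then show ?thesis
    by (cases z) (simp add: coarsen_def dyadic_grid_def div_less_iff_less_mult)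
qed

lemma sum_div_power:
  fixes F :: "nat \<Rightarrow> real"
  shows "(\<Sum>a<2 ^ (s + u). F (a div 2 ^ u)) = 2 ^ u * (\<Sum>a<2 ^ s. F a)"
proof -
  have "(\<Sum>a<2 ^ (s + u). F (a div 2 ^ u)) = (\<Sum>a<2 ^ s * 2 ^ u. F (a div 2 ^ u))"
    by (simp add: power_add)
  also have "\<dots> = (\<Sum>m<2 ^ s. \<Sum>a\<in>{m * 2 ^ u..<m * 2 ^ u + 2 ^ u}. F (a div 2 ^ u))"
    by (rule sum.nat_group[symmetric])
  also have "\<dots> = (\<Sum>m<2 ^ s. \<Sum>a\<in>{m * 2 ^ u..<m * 2 ^ u + 2 ^ u}. F m)"
  proof (intro sum.cong refl arg_cong[where f = F])
    fix m a :: nat assume "a \<in> {m * 2 ^ u..<m * 2 ^ u + 2 ^ u}"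
    then show "a div 2 ^ u = m" by (intro div_nat_eqI) (auto simp: mult.commute)
  qed
  finally show ?thesis by (simp add: sum_distrib_left)
qed

lemma sum_coarsen:
  fixes F :: "nat \<times> nat \<Rightarrow> real"
  assumes "s \<le> t"
  shows "(\<Sum>z\<in>dyadic_grid t. F (coarsen (t - s) z)) = 4 ^ (t - s) * (\<Sum>z\<in>dyadic_grid s. F z)"
proof -
  define u where "u = t - s"
  have t: "t = s + u" using assms by (simp add: u_def)
  have "(\<Sum>z\<in>dyadic_grid t. F (coarsen u z)) =
      (\<Sum>a<2 ^ (s + u). \<Sum>b<2 ^ (s + u). F (a div 2 ^ u, b div 2 ^ u))"
    by (simp add: dyadic_grid_def coarsen_def sum.cartesian_product split_beta t)
  also have "\<dots> = 2 ^ u * (\<Sum>a<2 ^ s. 2 ^ u * (\<Sum>b<2 ^ s. F (a, b)))"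
    unfolding sum_div_power[where F = "\<lambda>b. F (_, b)"]
      sum_div_power[where F = "\<lambda>a. 2 ^ u * (\<Sum>b<2 ^ s. F (a, b))"] ..
  also have "\<dots> = (2 ^ u * 2 ^ u) * (\<Sum>z\<in>dyadic_grid s. F z)"
    by (simp add: dyadic_grid_def sum.cartesian_product flip: sum_distrib_left)
  also have "(2 ^ u * 2 ^ u :: real) = 4 ^ u" by (simp add: power_mult_distrib[symmetric])
  finally show ?thesis by (simp add: u_def)
qed

text \<open>By \<open>mart\<close>, the coarse density is the conditional expectation of the fine
  one. Taking the identity as fine labelling in \<open>block_avg_Pythagoras\<close> makes the
  normalized squared L2 distance equal to \<open>e t - e s\<close>, and Cauchy-Schwarz passes to L1.
  Sums run over the finer grid, each block weighing \<open>1 / 4 ^ t\<close>.\<close>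

lemma dyadic_martingale_L1_Cauchy:
  fixes D :: "nat \<Rightarrow> nat \<times> nat \<Rightarrow> real"
  assumes D01: "\<And>N z. 0 \<le> D N z \<and> D N z \<le> 1"
    and mart: "\<And>s t z. s \<le> t \<Longrightarrow> z \<in> dyadic_grid t \<Longrightarrow>
      D s (coarsen (t - s) z) = block_avg (dyadic_grid t) (coarsen (t - s)) (D t) z"
    and "\<epsilon> > 0"
  shows "\<exists>T. \<forall>s\<ge>T. \<forall>t\<ge>s. (\<Sum>z\<in>dyadic_grid t. \<bar>D t z - D s (coarsen (t - s) z)\<bar>) / 4 ^ t < \<epsilon>"
proof -
  define e where "e s = (\<Sum>z\<in>dyadic_grid s. (D s z)\<^sup>2) / 4 ^ s" for s
  have e1: "e s \<le> 1" for s
  proof -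
    have "(\<Sum>z\<in>dyadic_grid s. (D s z)\<^sup>2) \<le> (\<Sum>z\<in>dyadic_grid s. 1)"
      using D01 by (intro sum_mono power_le_one) auto
    then show ?thesis by (simp add: e_def card_dyadic_grid)
  qed
  have key: "((\<Sum>z\<in>dyadic_grid t. \<bar>D t z - D s (coarsen (t - s) z)\<bar>) / 4 ^ t)\<^sup>2 \<le> e t - e s"
    if st: "s \<le> t" for s t
  proof -
    let ?X = "dyadic_grid t" and ?r = "coarsen (t - s)"
    have "(4::real) ^ t = 4 ^ s * 4 ^ (t - s)" using st by (simp flip: power_add)
    then have es: "(\<Sum>z\<in>?X. (D s (?r z))\<^sup>2) = 4 ^ t * e s"
      unfolding sum_coarsen[OF st, of "\<lambda>z. (D s z)\<^sup>2"] by (simp add: e_def)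
    have "(\<Sum>z\<in>?X. (D t z - D s (?r z))\<^sup>2) =
        (\<Sum>z\<in>?X. (block_avg ?X id (D t) z - block_avg ?X ?r (D t) z)\<^sup>2)"
    proof (intro sum.cong refl)
      fix z assume z: "z \<in> ?X"
      have "block_avg ?X id (D t) z = D t z" by (rule block_avg_fixed) (use z in auto)
      then show "(D t z - D s (?r z))\<^sup>2 = (block_avg ?X id (D t) z - block_avg ?X ?r (D t) z)\<^sup>2"
        by (simp add: mart[OF st z])
    qed
    also have "\<dots> = (\<Sum>z\<in>?X. (block_avg ?X id (D t) z)\<^sup>2) - (\<Sum>z\<in>?X. (block_avg ?X ?r (D t) z)\<^sup>2)"
      by (rule block_avg_Pythagoras) auto
    also have "(\<Sum>z\<in>?X. (block_avg ?X id (D t) z)\<^sup>2) = (\<Sum>z\<in>?X. (D t z)\<^sup>2)"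
      by (intro sum.cong refl arg_cong[where f = "\<lambda>x. x\<^sup>2"] block_avg_fixed) auto
    also have "(\<Sum>z\<in>?X. (block_avg ?X ?r (D t) z)\<^sup>2) = (\<Sum>z\<in>?X. (D s (?r z))\<^sup>2)"
      by (intro sum.cong refl arg_cong[where f = "\<lambda>x. x\<^sup>2"] mart[OF st, symmetric])
    finally have sq: "(\<Sum>z\<in>?X. (D t z - D s (?r z))\<^sup>2) = 4 ^ t * (e t - e s)"
      by (simp add: es e_def right_diff_distrib)
    have "(\<Sum>z\<in>?X. \<bar>D t z - D s (?r z)\<bar> * 1)\<^sup>2 \<le>
        (\<Sum>z\<in>?X. \<bar>D t z - D s (?r z)\<bar>\<^sup>2) * (\<Sum>z\<in>?X. 1\<^sup>2)"
      by (rule Cauchy_Schwarz_ineq_sum)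
    also have "\<dots> = (4 ^ t * (e t - e s)) * 4 ^ t"
      by (simp add: sq card_dyadic_grid)
    also have "\<dots> = (4 ^ t)\<^sup>2 * (e t - e s)"
      by (simp add: power2_eq_square)
    finally show ?thesis by (simp add: power_divide field_simps)
  qed
  have "e s \<le> e t" if "s \<le> t" for s t
    using key[OF that] by (smt (verit) zero_le_power2)
  then have "incseq e" by (simp add: incseq_def)
  then obtain l where "e \<longlonglongrightarrow> l"
    using incseq_convergent[of e 1] e1 by blast
  then have "convergent e" by (rule convergentI)
  then have "Cauchy e" by (rule convergent_Cauchy)
  then obtain T where T: "\<And>s t. s \<ge> T \<Longrightarrow> t \<ge> T \<Longrightarrow> \<bar>e s - e t\<bar> < \<epsilon>\<^sup>2"
    using metric_CauchyD[of e "\<epsilon>\<^sup>2"] assms(3) by (auto simp: dist_real_def)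
  have "(\<Sum>z\<in>dyadic_grid t. \<bar>D t z - D s (coarsen (t - s) z)\<bar>) / 4 ^ t < \<epsilon>" if "s \<ge> T" "t \<ge> s" for s t
  proof (rule power_less_imp_less_base)
    show "((\<Sum>z\<in>dyadic_grid t. \<bar>D t z - D s (coarsen (t - s) z)\<bar>) / 4 ^ t)\<^sup>2 < \<epsilon>\<^sup>2"
      using key[OF that(2)] T[of t s] that by linarith
  qed (use assms(3) in simp)
  then show ?thesis by blast
qed

text \<open>The coarse floor is the fine floor divided by a power of two, so both graphons are
  constant on fine blocks and their absolute difference is again a step graphon of level
  \<open>t\<close>.\<close>

lemma step_graphon_diff_L1:
  assumes st: "s \<le> t" and supp: "\<And>N z. z \<notin> dyadic_grid N \<Longrightarrow> D N z = 0"
  shows "(\<integral>z. indicator unit_square z *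
      \<bar>step_graphon t (D t) (fst z) (snd z) - step_graphon s (D s) (fst z) (snd z)\<bar> \<partial>lborel) \<le>
    (\<Sum>z\<in>dyadic_grid t. \<bar>D t z - D s (coarsen (t - s) z)\<bar>) / 4 ^ t"
proof -
  define F where "F z = \<bar>D t z - D s (coarsen (t - s) z)\<bar>" for z
  have idx: "nat \<lfloor>2 ^ t * x\<rfloor> div 2 ^ (t - s) = nat \<lfloor>2 ^ s * x\<rfloor>" for x :: real
  proof -
    have "(2::real) ^ t = 2 ^ s * 2 ^ (t - s)" using st by (simp flip: power_add)
    then have "2 ^ s * x = 2 ^ t * x / real_of_int (2 ^ (t - s))" by simp
    then have "\<lfloor>2 ^ s * x\<rfloor> = \<lfloor>2 ^ t * x\<rfloor> div 2 ^ (t - s)"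
      by (simp only: floor_divide_real_eq_div zero_le_power zero_le_numeral)
    then show ?thesis by (simp add: nat_div_distrib' nat_power_eq)
  qed
  have eq: "\<bar>step_graphon t (D t) x y - step_graphon s (D s) x y\<bar> = step_graphon t F x y" for x y
    by (simp add: step_graphon_def F_def coarsen_def idx)
  have "(\<integral>z. indicator unit_square z * step_graphon t F (fst z) (snd z) \<partial>lborel) \<le>
     (\<Sum>z\<in>dyadic_grid t. F z) / 4 ^ t"
    unfolding dyadic_grid_def
  proof (rule integral_step_le)
    fix z :: "nat \<times> nat" assume "z \<notin> {..<2 ^ t} \<times> {..<2 ^ t}"
    then have z: "z \<notin> dyadic_grid t" by (simp add: dyadic_grid_def)
    then have "coarsen (t - s) z \<notin> dyadic_grid s" using coarsen_in_grid_iff[OF st] by simp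
    with z show "F z = 0" by (simp add: F_def supp)
  qed (simp add: F_def)
  then show ?thesis by (simp add: eq F_def)
qed

lemma graphon_of_dyadic_martingale:
  fixes D :: "nat \<Rightarrow> nat \<times> nat \<Rightarrow> real" and L :: "nat \<Rightarrow> nat"
  assumes D01: "\<And>N z. 0 \<le> D N z \<and> D N z \<le> 1"
    and supp: "\<And>N z. z \<notin> dyadic_grid N \<Longrightarrow> D N z = 0"
    and mart: "\<And>s t z. s \<le> t \<Longrightarrow> z \<in> dyadic_grid t \<Longrightarrow>
      D s (coarsen (t - s) z) = block_avg (dyadic_grid t) (coarsen (t - s)) (D t) z"
    and L: "strict_mono L"
  shows "\<exists>W. asym_graphon W \<and> (\<forall>\<epsilon>>0. \<forall>T. \<exists>t\<ge>T.
     (\<integral>z. indicator unit_square z *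
        \<bar>step_graphon (L t) (D (L t)) (fst z) (snd z) - W (fst z) (snd z)\<bar> \<partial>lborel) < \<epsilon>)"
proof -
  \<comment> \<open>A density on the plane keeps the full Borel sigma-algebra, so the limit is
    measurable on the plane as \<open>asym_graphon\<close> requires.\<close>
  define M where "M = density lborel (\<lambda>z. ennreal (indicator unit_square z))"
  define f where "f t z = step_graphon (L t) (D (L t)) (fst z) (snd z)" for t z
  have sets_M: "sets M = sets borel" by (simp add: M_def)
  have fm[measurable]: "f t \<in> borel_measurable borel" for t
    unfolding f_def by (rule borel_measurable_step_graphon)
  have f01: "0 \<le> f t z \<and> f t z \<le> 1" for t z
    using D01 by (simp add: f_def step_graphon_def)
  have ind[measurable]: "(indicator unit_square :: _ \<Rightarrow> real) \<in> borel_measurable borel"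
    using unit_square_measure(1) by (intro borel_measurable_indicator) simp
  have int: "(\<integral>z. h z \<partial>M) = (\<integral>z. indicator unit_square z * h z \<partial>lborel)"
    if "h \<in> borel_measurable borel" for h :: "real \<times> real \<Rightarrow> real"
    unfolding M_def using that ind by (subst integral_density) auto
  have "emeasure M (space M) = emeasure lborel unit_square"
    unfolding M_def using unit_square_measure(1)
    by (subst emeasure_density) (auto simp: ennreal_indicator intro!: nn_integral_cong)
  then have fin: "finite_measure M"
    using unit_square_measure(2) by (intro finite_measureI) (simp add: less_top)
  have L1: "(\<integral>z. \<bar>f t z - f s z\<bar> \<partial>M) \<le>
      (\<Sum>z\<in>dyadic_grid (L t). \<bar>D (L t) z - D (L s) (coarsen (L t - L s) z)\<bar>) / 4 ^ L t"
    if "s \<le> t" for s t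
  proof -
    have "L s \<le> L t" using that L by (simp add: strict_mono_less_eq)
    from step_graphon_diff_L1[OF this supp] show ?thesis
      by (subst int) (simp_all add: f_def)
  qed
  have "\<exists>g. g \<in> borel_measurable M \<and> (\<forall>x. 0 \<le> g x \<and> g x \<le> 1) \<and>
     (\<forall>\<epsilon>>0. \<forall>T. \<exists>t\<ge>T. (\<integral>x. \<bar>f t x - g x\<bar> \<partial>M) < \<epsilon>)"
  proof (rule L1_Cauchy_limit_point[OF fin _ f01])
    show "f t \<in> borel_measurable M" for t
      using fm measurable_cong_sets[OF sets_M refl] by blast
    fix \<epsilon> :: real assume "\<epsilon> > 0"
    from dyadic_martingale_L1_Cauchy[OF D01 mart this] obtain T where T: "\<And>s t. s \<ge> T \<Longrightarrow> t \<ge> s \<Longrightarrow>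
      (\<Sum>z\<in>dyadic_grid t. \<bar>D t z - D s (coarsen (t - s) z)\<bar>) / 4 ^ t < \<epsilon>"
      by blast
    have *: "(\<integral>z. \<bar>f t z - f s z\<bar> \<partial>M) < \<epsilon>" if "s \<ge> T" "t \<ge> s" for s t
    proof -
      have "T \<le> L s" "L s \<le> L t"
        using that seq_suble[OF L, of s] L by (simp_all add: strict_mono_less_eq)
      from le_less_trans[OF L1[OF that(2)] T[OF this]] show ?thesis .
    qed
    show "\<exists>T. \<forall>s\<ge>T. \<forall>t\<ge>T. (\<integral>x. \<bar>f s x - f t x\<bar> \<partial>M) < \<epsilon>"
    proof (intro exI[of _ T] allI impI)
      fix s t assume "s \<ge> T" "t \<ge> T"
      then show "(\<integral>x. \<bar>f s x - f t x\<bar> \<partial>M) < \<epsilon>"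
        using *[of s t] *[of t s] by (cases "s \<le> t") (simp_all add: abs_minus_commute)
    qed
  qed
  then obtain g where g: "g \<in> borel_measurable M" "\<And>x. 0 \<le> g x \<and> g x \<le> 1"
     "\<And>\<epsilon> T. \<epsilon> > 0 \<Longrightarrow> \<exists>t\<ge>T. (\<integral>x. \<bar>f t x - g x\<bar> \<partial>M) < \<epsilon>"
    by blast
  have gm[measurable]: "g \<in> borel_measurable borel"
    using g(1) measurable_cong_sets[OF sets_M refl] by blast
  show ?thesis
  proof (rule exI[of _ "\<lambda>x y. g (x, y)"], intro conjI allI impI)
    show "asym_graphon (\<lambda>x y. g (x, y))"
      using gm g(2) by (simp add: asym_graphon_def)
    fix \<epsilon> :: real and T :: nat assume "\<epsilon> > 0"
    then obtain t where t: "t \<ge> T" "(\<integral>x. \<bar>f t x - g x\<bar> \<partial>M) < \<epsilon>" using g(3) by blast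
    have "(\<integral>x. \<bar>f t x - g x\<bar> \<partial>M) = (\<integral>z. indicator unit_square z * \<bar>f t z - g z\<bar> \<partial>lborel)"
      by (rule int) measurable
    with t show "\<exists>t\<ge>T. (\<integral>z. indicator unit_square z *
        \<bar>step_graphon (L t) (D (L t)) (fst z) (snd z) - g (fst z, snd z)\<bar> \<partial>lborel) < \<epsilon>"
      by (intro exI[of _ t]) (simp add: f_def)
  qed
qed

subsection \<open>Cut distance and block masses\<close>

lemma cut_norm_le:
  assumes "cut_le m n (\<lambda>z. A (fst z) (snd z)) \<epsilon>" "m > 0" "n > 0"
  shows "cut_norm m n A \<le> \<epsilon>"
proof -
  let ?S = "{\<bar>\<Sum>i<m. \<Sum>j<n. x i * A i j * y j\<bar> | x y.
            (\<forall>i<m. \<bar>x i\<bar> \<le> 1) \<and> (\<forall>j<n. \<bar>y j\<bar> \<le> 1)}"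
  have "Sup ?S \<le> \<epsilon> * (real m * real n)"
  proof (rule cSup_least)
    show "?S \<noteq> {}" by (auto intro!: exI[of _ "\<lambda>_. 0"])
    fix s assume "s \<in> ?S"
    then obtain x y where s: "s = \<bar>\<Sum>i<m. \<Sum>j<n. x i * A i j * y j\<bar>"
      and x: "\<forall>i<m. \<bar>x i\<bar> \<le> 1" and y: "\<forall>j<n. \<bar>y j\<bar> \<le> 1" by blast
    \<comment> \<open>Extension by 0 turns vectors bounded only inside the range into test vectors
      for \<open>cut_le\<close>.\<close>
    define x' y' where "x' i = (if i < m then x i else 0)" and "y' j = (if j < n then y j else 0)" for i j
    have "(\<Sum>i<m. \<Sum>j<n. x i * A i j * y j) =
        (\<Sum>z\<in>{..<m} \<times> {..<n}. A (fst z) (snd z) * (x' (fst z) * y' (snd z)))"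
      unfolding sum.cartesian_product by (rule sum.cong) (auto simp: x'_def y'_def)
    moreover have "\<bar>\<Sum>z\<in>{..<m} \<times> {..<n}. A (fst z) (snd z) * (x' (fst z) * y' (snd z))\<bar>
        \<le> \<epsilon> * (real m * real n)"
      by (rule cut_leD[OF assms(1)]) (use x y in \<open>auto simp: x'_def y'_def\<close>)
    ultimately show "s \<le> \<epsilon> * (real m * real n)" using s by simp
  qed
  then show ?thesis
    unfolding cut_norm_def using assms(2,3) by (simp add: field_simps)
qed

lemma cut_norm_nonneg: "0 \<le> cut_norm m n A"
proof -
  let ?S = "{\<bar>\<Sum>i<m. \<Sum>j<n. x i * A i j * y j\<bar> | x y.
            (\<forall>i<m. \<bar>x i\<bar> \<le> 1) \<and> (\<forall>j<n. \<bar>y j\<bar> \<le> 1)}"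
  have "0 \<le> Sup ?S"
  proof (rule cSup_upper)
    show "0 \<in> ?S" by (rule CollectI, rule exI[of _ "\<lambda>_. 0"], rule exI[of _ "\<lambda>_. 0"]) simp
    show "bdd_above ?S"
    proof (rule bdd_aboveI[where M = "\<Sum>i<m. \<Sum>j<n. \<bar>A i j\<bar>"])
      fix s assume "s \<in> ?S"
      then obtain x y where s: "s = \<bar>\<Sum>i<m. \<Sum>j<n. x i * A i j * y j\<bar>"
        and x: "\<forall>i<m. \<bar>x i\<bar> \<le> 1" and y: "\<forall>j<n. \<bar>y j\<bar> \<le> 1" by blast
      have "s \<le> (\<Sum>i<m. \<Sum>j<n. \<bar>x i * A i j * y j\<bar>)"
        unfolding s by (rule order_trans[OF sum_abs sum_mono]) (rule sum_abs)
      also have "\<dots> \<le> (\<Sum>i<m. \<Sum>j<n. \<bar>A i j\<bar>)"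
      proof (intro sum_mono)
        fix i j assume "i \<in> {..<m}" "j \<in> {..<n}"
        then have "\<bar>x i\<bar> * \<bar>y j\<bar> \<le> 1 * 1" using x y by (intro mult_mono) auto
        then have "\<bar>A i j\<bar> * (\<bar>x i\<bar> * \<bar>y j\<bar>) \<le> \<bar>A i j\<bar> * 1" by (intro mult_left_mono) auto
        then show "\<bar>x i * A i j * y j\<bar> \<le> \<bar>A i j\<bar>" by (simp add: abs_mult mult_ac)
      qed
      finally show "s \<le> (\<Sum>i<m. \<Sum>j<n. \<bar>A i j\<bar>)" .
    qed
  qed
  then show ?thesis unfolding cut_norm_def by simp
qed

lemma finite_permutation_pairs: "finite ({\<pi>. \<pi> permutes {..<m :: nat}} \<times> {\<tau>. \<tau> permutes {..<n :: nat}})"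
  by (simp add: finite_permutations)

lemma delta_box_nonneg: "0 \<le> delta_box m n A B"
proof -
  let ?S = "(\<lambda>(\<pi>, \<tau>). cut_norm m n (\<lambda>i j. A (\<pi> i) (\<tau> j) - B i j)) `
       ({\<pi>. \<pi> permutes {..<m}} \<times> {\<tau>. \<tau> permutes {..<n}})"
  have "finite ?S" by (rule finite_imageI[OF finite_permutation_pairs])
  moreover have "(id, id) \<in> {\<pi>. \<pi> permutes {..<m}} \<times> {\<tau>. \<tau> permutes {..<n}}"
    by (simp only: mem_Sigma_iff mem_Collect_eq permutes_id simp_thms)
  ultimately have "Min ?S \<in> ?S" by (intro Min_in) blast+
  then show ?thesis unfolding delta_box_def using cut_norm_nonneg by force
qed

lemma delta_box_le:
  assumes "\<sigma> permutes {..<m}" "\<tau> permutes {..<n}" "m > 0" "n > 0"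
    and "cut_le m n (\<lambda>z. A (\<sigma> (fst z)) (\<tau> (snd z)) - B (fst z) (snd z)) \<epsilon>"
  shows "delta_box m n A B \<le> \<epsilon>"
proof -
  have "delta_box m n A B \<le> cut_norm m n (\<lambda>i j. A (\<sigma> i) (\<tau> j) - B i j)"
    unfolding delta_box_def
    using assms(1,2) by (intro Min_le finite_imageI finite_permutation_pairs) force
  also have "\<dots> \<le> \<epsilon>" by (rule cut_norm_le) (use assms in auto)
  finally show ?thesis .
qed

section \<open>Fractions and masses of cells\<close>

definition cell_fraction :: "nat \<Rightarrow> nat \<Rightarrow> nat \<Rightarrow> real" where
  "cell_fraction m N a = real (card {i. i < m \<and> cell m N i = a}) / real m"

text \<open>Normalized by the whole matrix rather than by the block: masses of fine blocks then add
  up exactly to masses of coarse blocks, whereas averages would need weights because cells have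
  unequal sizes.\<close>

definition cell_mass :: "nat \<Rightarrow> nat \<Rightarrow> nat \<Rightarrow> (nat \<times> nat \<Rightarrow> real) \<Rightarrow> nat \<times> nat \<Rightarrow> real" where
  "cell_mass m n N f w =
     (\<Sum>z | z \<in> {..<m} \<times> {..<n} \<and> map_prod (cell m N) (cell n N) z = w. f z) / (real m * real n)"

lemma cell_fraction_tendsto:
  assumes "filterlim m at_top sequentially" "a < 2 ^ N"
  shows "(\<lambda>k. cell_fraction (m k) N a) \<longlonglongrightarrow> 1 / 2 ^ N"
proof -
  have lim: "(\<lambda>k. 1 / real (m k)) \<longlonglongrightarrow> 0"
    using filterlim_compose[OF lim_1_over_n assms(1)] by simp
  have "eventually (\<lambda>k. 1 \<le> m k) sequentially"
    using assms(1) by (simp add: filterlim_at_top)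
  then have "eventually (\<lambda>k. norm (cell_fraction (m k) N a - 1 / 2 ^ N) \<le> 1 / real (m k)) sequentially"
  proof eventually_elim
    case (elim k)
    have "\<bar>real (card {i. i < m k \<and> cell (m k) N i = a}) - real (m k) / 2 ^ N\<bar> / real (m k) \<le> 1 / real (m k)"
      by (intro divide_right_mono card_cell assms(2)) simp
    moreover have "cell_fraction (m k) N a - 1 / 2 ^ N =
       (real (card {i. i < m k \<and> cell (m k) N i = a}) - real (m k) / 2 ^ N) / real (m k)"
      using elim by (simp add: cell_fraction_def diff_divide_distrib)
    ultimately show ?case by (simp add: abs_divide)
  qed
  then have "(\<lambda>k. cell_fraction (m k) N a - 1 / 2 ^ N) \<longlonglongrightarrow> 0"
    by (rule Lim_null_comparison) (rule lim)
  then show ?thesis by (simp add: LIM_zero_iff)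
qed

lemma cell_block_eq:
  "{z. z \<in> {..<m} \<times> {..<n} \<and> map_prod (cell m N) (cell n N) z = (a, b)} =
     {i. i < m \<and> cell m N i = a} \<times> {j. j < n \<and> cell n N j = b}"
  by auto

lemma cell_mass_bounds:
  assumes f: "\<And>z. z \<in> {..<m} \<times> {..<n} \<Longrightarrow> 0 \<le> f z \<and> f z \<le> 1"
  shows "0 \<le> cell_mass m n N f (a, b)"
    and "cell_mass m n N f (a, b) \<le> cell_fraction m N a * cell_fraction n N b"
proof -
  let ?Z = "{z. z \<in> {..<m} \<times> {..<n} \<and> map_prod (cell m N) (cell n N) z = (a, b)}"
  show "0 \<le> cell_mass m n N f (a, b)"
    unfolding cell_mass_def using f by (intro divide_nonneg_nonneg sum_nonneg) auto
  have "(\<Sum>z\<in>?Z. f z) \<le> (\<Sum>z\<in>?Z. 1)"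
    using f by (intro sum_mono) blast
  also have "\<dots> = real (card {i. i < m \<and> cell m N i = a}) * real (card {j. j < n \<and> cell n N j = b})"
    unfolding cell_block_eq by (simp add: card_cartesian_product)
  finally have "(\<Sum>z\<in>?Z. f z) / (real m * real n) \<le>
     real (card {i. i < m \<and> cell m N i = a}) * real (card {j. j < n \<and> cell n N j = b}) / (real m * real n)"
    by (rule divide_right_mono) simp
  then show "cell_mass m n N f (a, b) \<le> cell_fraction m N a * cell_fraction n N b"
    by (simp add: cell_mass_def cell_fraction_def)
qed

lemma cell_mass_outside:
  assumes "w \<notin> dyadic_grid N"
  shows "cell_mass m n N f w = 0"
proof -
  have "{z. z \<in> {..<m} \<times> {..<n} \<and> map_prod (cell m N) (cell n N) z = w} = {}"
    using assms cell_less by (fastforce simp: dyadic_grid_def)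
  then show ?thesis unfolding cell_mass_def by (simp only: sum.empty div_0)
qed

lemma cell_fraction_le_1: "cell_fraction m N a \<le> 1"
proof -
  have "card {i. i < m \<and> cell m N i = a} \<le> card {..<m}" by (intro card_mono) auto
  then show ?thesis by (cases "m = 0") (simp_all add: cell_fraction_def field_simps)
qed

lemma cell_mass_in_unit:
  assumes f: "\<And>z. z \<in> {..<m} \<times> {..<n} \<Longrightarrow> 0 \<le> f z \<and> f z \<le> 1"
  shows "cell_mass m n N f w \<in> {0..1}"
proof -
  obtain a b where w: "w = (a, b)" by (cases w)
  have "cell_mass m n N f w \<le> cell_fraction m N a * cell_fraction n N b"
    unfolding w by (rule cell_mass_bounds[OF f])
  also have "\<dots> \<le> 1 * 1"
    by (intro mult_mono cell_fraction_le_1) (simp_all add: cell_fraction_def)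
  finally show ?thesis using cell_mass_bounds(1)[of m n f N a b, OF f] w by simp
qed

lemma cell_mass_additive:
  assumes "s \<le> t"
  shows "cell_mass m n s f w = (\<Sum>v | v \<in> dyadic_grid t \<and> coarsen (t - s) v = w. cell_mass m n t f v)"
proof -
  let ?X = "{..<m} \<times> {..<n}" and ?c = "\<lambda>N. map_prod (cell m N) (cell n N)"
  let ?T = "{v \<in> dyadic_grid t. coarsen (t - s) v = w}"
  have co: "coarsen (t - s) (?c t z) = ?c s z" for z
    using cell_coarsen[OF assms] by (cases z) (simp add: coarsen_def)
  have grp: "(\<Sum>v\<in>?T. sum f {z \<in> {z \<in> ?X. ?c s z = w}. ?c t z = v}) = sum f {z \<in> ?X. ?c s z = w}"
  proof (rule sum.group)
    show "?c t ` {z \<in> ?X. ?c s z = w} \<subseteq> ?T"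
    proof (rule image_subsetI)
      fix z assume z: "z \<in> {z \<in> ?X. ?c s z = w}"
      then have "?c t z \<in> dyadic_grid t" by (auto simp: dyadic_grid_def cell_less)
      moreover have "coarsen (t - s) (?c t z) = w" using z by (simp only: co mem_Collect_eq)
      ultimately show "?c t z \<in> ?T" by simp
    qed
  qed simp_all
  have fib: "{z \<in> {z \<in> ?X. ?c s z = w}. ?c t z = v} = {z \<in> ?X. ?c t z = v}" if "v \<in> ?T" for v
  proof -
    have "?c s z = w" if "?c t z = v" for z
      using co[of z] \<open>v \<in> ?T\<close> by (simp add: that)
    then show ?thesis by blast
  qed
  have "(\<Sum>v\<in>?T. sum f {z \<in> ?X. ?c t z = v}) =
      (\<Sum>v\<in>?T. sum f {z \<in> {z \<in> ?X. ?c s z = w}. ?c t z = v})"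
    by (rule sum.cong[OF refl]) (simp only: fib)
  also note grp
  finally show ?thesis
    unfolding cell_mass_def sum_divide_distrib[symmetric] by (simp only:)
qed

lemma cell_avg_eq_mass:
  assumes "m > 0" "n > 0"
  shows "cell_avg m n N f (i, j) = cell_mass m n N f (cell m N i, cell n N j) /
     (cell_fraction m N (cell m N i) * cell_fraction n N (cell n N j))"
proof -
  have *: "{w \<in> {..<m} \<times> {..<n}. map_prod (cell m N) (cell n N) w = map_prod (cell m N) (cell n N) (i, j)} =
     {i'. i' < m \<and> cell m N i' = cell m N i} \<times> {j'. j' < n \<and> cell n N j' = cell n N j}"
    using cell_block_eq[of m n N "cell m N i" "cell n N j"] by simp
  show ?thesis
    unfolding cell_avg_def block_avg_def cell_mass_def cell_fraction_def *
    using assms by (simp add: card_cartesian_product cell_block_eq)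
qed

text \<open>\<open>sum_coarsen\<close> applied to the indicator of one coarse block.\<close>

lemma card_coarsen_fiber:
  assumes "s \<le> t" "z \<in> dyadic_grid t"
  shows "real (card {v \<in> dyadic_grid t. coarsen (t - s) v = coarsen (t - s) z}) = 4 ^ (t - s)"
proof -
  have g: "coarsen (t - s) z \<in> dyadic_grid s" using assms coarsen_in_grid_iff by simp
  have "real (card {v \<in> dyadic_grid t. coarsen (t - s) v = coarsen (t - s) z}) =
      (\<Sum>v\<in>dyadic_grid t. of_bool (coarsen (t - s) v = coarsen (t - s) z))"
    by (simp add: Int_def)
  also have "\<dots> = 4 ^ (t - s) * (\<Sum>w\<in>dyadic_grid s. of_bool (w = coarsen (t - s) z))"
    by (rule sum_coarsen[OF assms(1)])
  also have "(\<Sum>w\<in>dyadic_grid s. of_bool (w = coarsen (t - s) z) :: real) = 1"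
    using g by (simp add: of_bool_def)
  finally show ?thesis by simp
qed

text \<open>Cell fractions tend to \<open>1 / 2 ^ N\<close>, so a block has limiting area
  \<open>1 / 4 ^ N\<close> and \<open>D\<close> is mass per area. Exact additivity of masses passes
  to the limit and becomes the martingale identity, since every coarse block has exactly
  \<open>4 ^ (t - s)\<close> fine ones.\<close>

lemma limit_densities:
  fixes m n :: "nat \<Rightarrow> nat" and f :: "nat \<Rightarrow> nat \<times> nat \<Rightarrow> real" and M D :: "nat \<Rightarrow> nat \<times> nat \<Rightarrow> real"
  assumes m: "filterlim m at_top sequentially" and n: "filterlim n at_top sequentially"
    and f: "\<And>k z. z \<in> {..<m k} \<times> {..<n k} \<Longrightarrow> 0 \<le> f k z \<and> f k z \<le> 1"
    and M: "\<And>N w. (\<lambda>k. cell_mass (m k) (n k) N (f k) w) \<longlonglongrightarrow> M N w"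
    and D: "\<And>N w. D N w = 4 ^ N * M N w"
  shows "0 \<le> D N w \<and> D N w \<le> 1"
    and "w \<notin> dyadic_grid N \<Longrightarrow> D N w = 0"
    and "s \<le> t \<Longrightarrow> z \<in> dyadic_grid t \<Longrightarrow>
      D s (coarsen (t - s) z) = block_avg (dyadic_grid t) (coarsen (t - s)) (D t) z"
    and "(\<lambda>k. \<Sum>w\<in>dyadic_grid N. \<bar>cell_mass (m k) (n k) N (f k) w /
      (cell_fraction (m k) N (fst w) * cell_fraction (n k) N (snd w)) - D N w\<bar>) \<longlonglongrightarrow> 0"
proof -
  have frac: "(\<lambda>k. cell_fraction (m k) N (fst w) * cell_fraction (n k) N (snd w)) \<longlonglongrightarrow> 1 / 4 ^ N"
    if "w \<in> dyadic_grid N" for N w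
  proof -
    have "(\<lambda>k. cell_fraction (m k) N (fst w) * cell_fraction (n k) N (snd w))
        \<longlonglongrightarrow> (1 / 2 ^ N) * (1 / 2 ^ N)"
      using that by (intro tendsto_mult cell_fraction_tendsto m n) (auto simp: dyadic_grid_def)
    also have "(1 / 2 ^ N) * (1 / 2 ^ N) = (1 / 4 ^ N :: real)"
      by (simp add: power_mult_distrib[symmetric])
    finally show ?thesis .
  qed
  have out: "D N w = 0" if "w \<notin> dyadic_grid N" for N w
  proof -
    have "(\<lambda>k. 0) \<longlonglongrightarrow> M N w" using M[of N w] by (simp add: cell_mass_outside[OF that])
    then have "M N w = 0" using LIMSEQ_unique tendsto_const by blast
    then show ?thesis by (simp add: D)
  qed
  then show "w \<notin> dyadic_grid N \<Longrightarrow> D N w = 0" .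
  show "0 \<le> D N w \<and> D N w \<le> 1"
  proof (cases "w \<in> dyadic_grid N")
    case True
    have "0 \<le> cell_mass (m k) (n k) N (f k) w" for k
      using cell_mass_bounds(1)[of "m k" "n k" "f k" N "fst w" "snd w", OF f] by simp
    then have "0 \<le> M N w" by (intro LIMSEQ_le_const[OF M]) blast
    moreover have "M N w \<le> 1 / 4 ^ N"
    proof (rule LIMSEQ_le[OF M frac[OF True]])
      have "cell_mass (m k) (n k) N (f k) w \<le>
          cell_fraction (m k) N (fst w) * cell_fraction (n k) N (snd w)" for k
        using cell_mass_bounds(2)[of "m k" "n k" "f k" N "fst w" "snd w", OF f] by simp
      then show "\<exists>K. \<forall>k\<ge>K. cell_mass (m k) (n k) N (f k) w \<le>
          cell_fraction (m k) N (fst w) * cell_fraction (n k) N (snd w)" by blast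
    qed
    ultimately show ?thesis by (simp add: D field_simps)
  qed (simp add: out)
  show "D s (coarsen (t - s) z) = block_avg (dyadic_grid t) (coarsen (t - s)) (D t) z"
    if st: "s \<le> t" and z: "z \<in> dyadic_grid t"
  proof -
    let ?V = "{v. v \<in> dyadic_grid t \<and> coarsen (t - s) v = coarsen (t - s) z}"
    have "(\<lambda>k. cell_mass (m k) (n k) s (f k) (coarsen (t - s) z)) \<longlonglongrightarrow> (\<Sum>v\<in>?V. M t v)"
      unfolding cell_mass_additive[OF st] by (intro tendsto_sum M)
    then have "M s (coarsen (t - s) z) = (\<Sum>v\<in>?V. M t v)"
      using LIMSEQ_unique M by blast
    moreover have "(4::real) ^ t = 4 ^ s * 4 ^ (t - s)" using st by (simp flip: power_add)
    ultimately show ?thesis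
      unfolding block_avg_def card_coarsen_fiber[OF st z] D by (simp flip: sum_distrib_left)
  qed
  have "(\<lambda>k. \<Sum>w\<in>dyadic_grid N. \<bar>cell_mass (m k) (n k) N (f k) w /
      (cell_fraction (m k) N (fst w) * cell_fraction (n k) N (snd w)) - D N w\<bar>)
      \<longlonglongrightarrow> (\<Sum>w\<in>dyadic_grid N. \<bar>M N w / (1 / 4 ^ N) - D N w\<bar>)"
    by (intro tendsto_sum tendsto_rabs tendsto_diff tendsto_divide M frac tendsto_const) auto
  also have "(\<Sum>w\<in>dyadic_grid N. \<bar>M N w / (1 / 4 ^ N) - D N w\<bar>) = 0"
    by (simp add: D)
  finally show "(\<lambda>k. \<Sum>w\<in>dyadic_grid N. \<bar>cell_mass (m k) (n k) N (f k) w /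
      (cell_fraction (m k) N (fst w) * cell_fraction (n k) N (snd w)) - D N w\<bar>) \<longlonglongrightarrow> 0" .
qed

text \<open>Where the row and column intervals each fit into one dyadic interval, the difference is
  that of the block densities, at most \<delta>. By \<open>card_incomplete_cells\<close> at most
  \<open>2 ^ N\<close> rows and \<open>2 ^ N\<close> columns do not fit, and their entries cost at
  most 1 each.\<close>

lemma cell_avg_discretize_L1:
  assumes mn: "m > 0" "n > 0"
    and f: "\<And>z. z \<in> {..<m} \<times> {..<n} \<Longrightarrow> 0 \<le> f z \<and> f z \<le> 1"
    and D: "\<And>w. 0 \<le> D w \<and> D w \<le> 1"
    and \<delta>: "(\<Sum>w\<in>dyadic_grid N. \<bar>cell_mass m n N f w /
      (cell_fraction m N (fst w) * cell_fraction n N (snd w)) - D w\<bar>) \<le> \<delta>"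
  shows "(\<Sum>z\<in>{..<m} \<times> {..<n}. \<bar>cell_avg m n N f z
      - discretize m n (step_graphon N D) (fst z) (snd z)\<bar>) \<le>
    (\<delta> + 2 ^ N / real m + 2 ^ N / real n) * (real m * real n)"
proof -
  let ?B = "\<lambda>m. {i. i < m \<and> \<not> Suc i * 2 ^ N \<le> Suc (cell m N i) * m}"
  let ?d = "\<lambda>w. \<bar>cell_mass m n N f w / (cell_fraction m N (fst w) * cell_fraction n N (snd w)) - D w\<bar>"
  have "0 \<le> (\<Sum>w\<in>dyadic_grid N. ?d w)" by (intro sum_nonneg) simp
  then have \<delta>0: "0 \<le> \<delta>" using \<delta> by linarith
  have "(\<Sum>z\<in>{..<m} \<times> {..<n}. \<bar>cell_avg m n N f z
      - discretize m n (step_graphon N D) (fst z) (snd z)\<bar>) \<le>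
    \<delta> * (real m * real n) + real (card (?B m)) * real n + real m * real (card (?B n))"
  proof (rule sum_grid_le)
    show "?B m \<subseteq> {..<m}" "?B n \<subseteq> {..<n}" by blast+
    show "0 \<le> \<delta>" by (rule \<delta>0)
  next
    fix i j assume "i < m" "j < n"
    then have ij: "(i, j) \<in> {..<m} \<times> {..<n}" by simp
    have "0 \<le> cell_avg m n N f (i, j)"
      unfolding cell_avg_def by (rule block_avg_ge[OF _ ij]) (use f in auto)
    moreover have "cell_avg m n N f (i, j) \<le> 1"
      unfolding cell_avg_def by (rule block_avg_le[OF _ ij]) (use f in auto)
    moreover have U: "0 \<le> step_graphon N D x y \<and> step_graphon N D x y \<le> 1" for x y
      unfolding step_graphon_def by (rule D)
    have "0 \<le> discretize m n (step_graphon N D) i j"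
      by (rule discretize_bounds(1)[OF mn borel_measurable_step_graphon U])
    moreover have "discretize m n (step_graphon N D) i j \<le> 1"
      by (rule discretize_bounds(2)[OF mn borel_measurable_step_graphon U])
    ultimately show "\<bar>cell_avg m n N f (i, j)
        - discretize m n (step_graphon N D) (fst (i, j)) (snd (i, j))\<bar> \<le> 1"
      by (simp add: abs_le_iff)
  next
    fix i j assume ij: "i < m" "j < n" and "i \<notin> ?B m" "j \<notin> ?B n"
    then have good: "Suc i * 2 ^ N \<le> Suc (cell m N i) * m" "Suc j * 2 ^ N \<le> Suc (cell n N j) * n"
      by blast+
    let ?w = "(cell m N i, cell n N j)"
    have "\<bar>cell_avg m n N f (i, j) - discretize m n (step_graphon N D) i j\<bar> = ?d ?w"
      unfolding discretize_step_graphon[OF mn good] cell_avg_eq_mass[OF mn] by simp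
    also have "\<dots> \<le> (\<Sum>w\<in>dyadic_grid N. ?d w)"
      by (rule member_le_sum) (use ij in \<open>auto simp: dyadic_grid_def cell_less\<close>)
    finally show "\<bar>cell_avg m n N f (i, j)
        - discretize m n (step_graphon N D) (fst (i, j)) (snd (i, j))\<bar> \<le> \<delta>"
      using \<delta> by simp
  qed
  also have "\<dots> \<le> \<delta> * (real m * real n) + 2 ^ N * real n + real m * 2 ^ N"
  proof -
    have "real (card (?B k)) \<le> 2 ^ N" if "k > 0" for k
    proof -
      have "real (card (?B k)) \<le> real (2 ^ N)"
        unfolding of_nat_le_iff by (rule card_incomplete_cells[OF that])
      then show ?thesis by simp
    qed
    from this[OF mn(1)] this[OF mn(2)] show ?thesis
      by (intro add_mono mult_left_mono mult_right_mono order_refl of_nat_0_le_iff)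
  qed
  also have "\<dots> = (\<delta> + 2 ^ N / real m + 2 ^ N / real n) * (real m * real n)"
    using mn by (simp add: field_simps)
  finally show ?thesis .
qed

section \<open>Assembly of the limit graphon\<close>

theorem theorem3p4:
  fixes P :: "nat \<Rightarrow> nat \<Rightarrow> nat \<Rightarrow> real" and m n :: "nat \<Rightarrow> nat"
  assumes "\<And>k. binary_matrix (m k) (n k) (P k)"
    and "filterlim m at_top sequentially"
    and "filterlim n at_top sequentially"
  shows "\<exists>r W. strict_mono r \<and> asym_graphon W \<and>
           (\<lambda>l. delta_box_graphon (m (r l)) (n (r l)) (P (r l)) W) \<longlonglongrightarrow> 0"
proof -
  from simultaneous_regularity obtain L :: "nat \<Rightarrow> nat" where L: "strict_mono L"
    and reg: "\<forall>m n f t. (\<forall>z\<in>{..<m} \<times> {..<n}. 0 \<le> f z \<and> f z \<le> 1) \<longrightarrow>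
     (\<exists>\<sigma> \<tau>. \<sigma> permutes {..<m} \<and> \<tau> permutes {..<n} \<and>
       (\<forall>s\<le>t. 2 ^ L s \<le> m \<longrightarrow> 2 ^ L s \<le> n \<longrightarrow>
         cut_le m n (\<lambda>z. (f \<circ> map_prod \<sigma> \<tau>) z - cell_avg m n (L s) (f \<circ> map_prod \<sigma> \<tau>) z)
           (1 / real (Suc s))))"
    by (elim exE conjE) (rule that)
  define A where "A k z = P k (fst z) (snd z)" for k z
  have A01: "\<forall>z\<in>{..<m k} \<times> {..<n k}. 0 \<le> A k z \<and> A k z \<le> 1" for k
    using assms(1)[of k] by (force simp: binary_matrix_def A_def)
  \<comment> \<open>Matrix \<open>k\<close> is prepared for the levels \<open>L s\<close> with
    \<open>s \<le> k\<close>, so any fixed level is eventually covered, also along a subsequence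
    because \<open>k \<le> r k\<close>.\<close>
  define good where "good k \<sigma> \<tau> \<longleftrightarrow> \<sigma> permutes {..<m k} \<and> \<tau> permutes {..<n k} \<and>
       (\<forall>s\<le>k. 2 ^ L s \<le> m k \<longrightarrow> 2 ^ L s \<le> n k \<longrightarrow>
         cut_le (m k) (n k) (\<lambda>z. (A k \<circ> map_prod \<sigma> \<tau>) z
           - cell_avg (m k) (n k) (L s) (A k \<circ> map_prod \<sigma> \<tau>) z) (1 / real (Suc s)))" for k \<sigma> \<tau>
  have "\<exists>\<sigma> \<tau>. good k \<sigma> \<tau>" for k
    unfolding good_def by (rule reg[THEN spec, THEN spec, THEN spec, THEN spec, THEN mp, OF A01])
  then obtain \<sigma> \<tau> where "\<And>k. good k (\<sigma> k) (\<tau> k)" by metis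
  then have \<sigma>: "\<And>k. \<sigma> k permutes {..<m k}" and \<tau>: "\<And>k. \<tau> k permutes {..<n k}"
    and cut: "\<And>k. \<forall>s\<le>k. 2 ^ L s \<le> m k \<longrightarrow> 2 ^ L s \<le> n k \<longrightarrow>
         cut_le (m k) (n k) (\<lambda>z. (A k \<circ> map_prod (\<sigma> k) (\<tau> k)) z
           - cell_avg (m k) (n k) (L s) (A k \<circ> map_prod (\<sigma> k) (\<tau> k)) z) (1 / real (Suc s))"
    unfolding good_def by - (drule meta_spec, elim conjE, assumption)+
  define f where "f k = A k \<circ> map_prod (\<sigma> k) (\<tau> k)" for k
  have f01: "0 \<le> f k z \<and> f k z \<le> 1" if "z \<in> {..<m k} \<times> {..<n k}" for k z
  proof -
    have "map_prod (\<sigma> k) (\<tau> k) z \<in> {..<m k} \<times> {..<n k}"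
      using bij_betwE[OF bij_betw_map_prod_permutes[OF \<sigma> \<tau>]] that by blast
    from bspec[OF A01 this] show ?thesis by (simp add: f_def)
  qed
  \<comment> \<open>The index is a pair of level and block, so one subsequence serves all levels at
    once.\<close>
  have "\<exists>r l. strict_mono (r :: nat \<Rightarrow> nat) \<and>
      (\<forall>c. (\<lambda>k. cell_mass (m (r k)) (n (r k)) (fst c) (f (r k)) (snd c)) \<longlonglongrightarrow> l c)"
    by (rule bounded_family_convergent_subseq) (rule cell_mass_in_unit[OF f01])
  then obtain r :: "nat \<Rightarrow> nat" and l where r: "strict_mono r"
    and l: "\<And>c. (\<lambda>k. cell_mass (m (r k)) (n (r k)) (fst c) (f (r k)) (snd c)) \<longlonglongrightarrow> l c"
    by blast
  define m' n' where "m' k = m (r k)" and "n' k = n (r k)" for k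
  have m': "filterlim m' at_top sequentially" and n': "filterlim n' at_top sequentially"
    unfolding m'_def n'_def
    using filterlim_compose[OF assms(2) filterlim_subseq[OF r]]
      filterlim_compose[OF assms(3) filterlim_subseq[OF r]] by simp_all
  define D where "D N w = 4 ^ N * l (N, w)" for N w
  have f': "0 \<le> f (r k) z \<and> f (r k) z \<le> 1" if "z \<in> {..<m' k} \<times> {..<n' k}" for k z
    using f01 that by (simp add: m'_def n'_def)
  have l': "(\<lambda>k. cell_mass (m' k) (n' k) N (f (r k)) w) \<longlonglongrightarrow> l (N, w)" for N w
    using l[of "(N, w)"] by (simp add: m'_def n'_def)
  note dens = limit_densities[where f = "\<lambda>k. f (r k)" and M = "\<lambda>N w. l (N, w)" and D = D,
      OF m' n' _ l' D_def]
  have D01: "0 \<le> D N w \<and> D N w \<le> 1" for N w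
    by (rule dens(1)) (rule f')
  have "\<exists>W. asym_graphon W \<and> (\<forall>\<epsilon>>0. \<forall>T. \<exists>t\<ge>T.
     (\<integral>z. indicator unit_square z *
        \<bar>step_graphon (L t) (D (L t)) (fst z) (snd z) - W (fst z) (snd z)\<bar> \<partial>lborel) < \<epsilon>)"
  proof (rule graphon_of_dyadic_martingale[OF _ _ _ L])
    show "0 \<le> D N z \<and> D N z \<le> 1" for N z by (rule D01)
    show "D N z = 0" if "z \<notin> dyadic_grid N" for N z
      by (rule dens(2)[OF f' that])
    show "D s (coarsen (t - s) z) = block_avg (dyadic_grid t) (coarsen (t - s)) (D t) z"
      if "s \<le> t" "z \<in> dyadic_grid t" for s t z
      by (rule dens(3)[OF f' that])
  qed
  then obtain W where W: "asym_graphon W" and approx: "\<And>\<epsilon> T. \<epsilon> > 0 \<Longrightarrow> \<exists>t\<ge>T.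
     (\<integral>z. indicator unit_square z *
        \<bar>step_graphon (L t) (D (L t)) (fst z) (snd z) - W (fst z) (snd z)\<bar> \<partial>lborel) < \<epsilon>"
    by blast
  have "(\<lambda>k. delta_box_graphon (m (r k)) (n (r k)) (P (r k)) W) \<longlonglongrightarrow> 0"
  proof (rule order_tendstoI)
    fix a :: real assume "a < 0"
    then show "\<forall>\<^sub>F k in sequentially. a < delta_box_graphon (m (r k)) (n (r k)) (P (r k)) W"
      unfolding delta_box_graphon_def
      by (intro always_eventually allI) (rule less_le_trans[OF _ delta_box_nonneg])
  next
    fix \<epsilon> :: real assume \<epsilon>: "0 < \<epsilon>"
    \<comment> \<open>The level is fixed before \<open>k\<close> grows. The budget is \<epsilon>/4
      for regularity, \<epsilon>/2 for densities and straddling rows and columns, and 4 times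
      \<epsilon>/16 for the L1 distance to \<open>W\<close>.\<close>
    obtain T where T: "4 / \<epsilon> < real T" using reals_Archimedean2 by blast
    obtain t where t: "t \<ge> T" and I: "(\<integral>z. indicator unit_square z *
        \<bar>step_graphon (L t) (D (L t)) (fst z) (snd z) - W (fst z) (snd z)\<bar> \<partial>lborel) < \<epsilon> / 16"
      using approx[of "\<epsilon> / 16" T] \<epsilon> by auto
    have small: "1 / real (Suc t) < \<epsilon> / 4"
    proof -
      have "4 / \<epsilon> < real (Suc t)" using T t by linarith
      then show ?thesis using \<epsilon> by (simp add: field_simps)
    qed
    let ?N = "L t"
    define \<delta> where "\<delta> k = (\<Sum>w\<in>dyadic_grid ?N. \<bar>cell_mass (m' k) (n' k) ?N (f (r k)) w /
      (cell_fraction (m' k) ?N (fst w) * cell_fraction (n' k) ?N (snd w)) - D ?N w\<bar>)" for k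
    have "(\<lambda>k. \<delta> k) \<longlonglongrightarrow> 0" unfolding \<delta>_def by (rule dens(4)) (rule f')
    moreover have "(\<lambda>k. 1 / real (m' k)) \<longlonglongrightarrow> 0" "(\<lambda>k. 1 / real (n' k)) \<longlonglongrightarrow> 0"
      using filterlim_compose[OF lim_1_over_n m'] filterlim_compose[OF lim_1_over_n n'] by simp_all
    ultimately have "(\<lambda>k. \<delta> k + 2 ^ ?N * (1 / real (m' k)) + 2 ^ ?N * (1 / real (n' k)))
        \<longlonglongrightarrow> 0 + 2 ^ ?N * 0 + 2 ^ ?N * 0"
      by (intro tendsto_intros)
    then have "(\<lambda>k. \<delta> k + 2 ^ ?N / real (m' k) + 2 ^ ?N / real (n' k)) \<longlonglongrightarrow> 0" by simp
    then have "\<forall>\<^sub>F k in sequentially. \<delta> k + 2 ^ ?N / real (m' k) + 2 ^ ?N / real (n' k) < \<epsilon> / 2"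
      by (rule order_tendstoD) (use \<epsilon> in simp)
    moreover have "\<forall>\<^sub>F k in sequentially. 2 ^ ?N \<le> m' k" "\<forall>\<^sub>F k in sequentially. 2 ^ ?N \<le> n' k"
      using m' n' by (simp_all add: filterlim_at_top)
    moreover have "\<forall>\<^sub>F k in sequentially. t \<le> k" by (rule eventually_ge_at_top)
    ultimately show "\<forall>\<^sub>F k in sequentially. delta_box_graphon (m (r k)) (n (r k)) (P (r k)) W < \<epsilon>"
    proof eventually_elim
      case (elim k)
      let ?X = "{..<m' k} \<times> {..<n' k}" and ?U = "step_graphon ?N (D ?N)"
      have pos: "m' k > 0" "n' k > 0"
        using less_le_trans[OF _ elim(2), of 0] less_le_trans[OF _ elim(3), of 0] by simp_all
      have "t \<le> r k" using elim(4) seq_suble[OF r, of k] by linarith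
      then have 1: "cut_le (m' k) (n' k) (\<lambda>z. f (r k) z - cell_avg (m' k) (n' k) ?N (f (r k)) z)
          (1 / real (Suc t))"
        using cut[of "r k", THEN spec, of t] elim(2,3) by (simp only: f_def m'_def n'_def simp_thms)
      have 2: "cut_le (m' k) (n' k) (\<lambda>z. cell_avg (m' k) (n' k) ?N (f (r k)) z
          - discretize (m' k) (n' k) ?U (fst z) (snd z))
          (\<delta> k + 2 ^ ?N / real (m' k) + 2 ^ ?N / real (n' k))"
      proof (rule cut_le_L1, rule cell_avg_discretize_L1[OF pos])
        show "0 \<le> f (r k) z \<and> f (r k) z \<le> 1" if "z \<in> ?X" for z using that by (rule f')
        show "0 \<le> D ?N w \<and> D ?N w \<le> 1" for w by (rule D01)
      qed (simp add: \<delta>_def)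
      have 3: "cut_le (m' k) (n' k) (\<lambda>z. discretize (m' k) (n' k) ?U (fst z) (snd z)
          - discretize (m' k) (n' k) W (fst z) (snd z))
          (4 * (\<integral>z. indicator unit_square z *
            \<bar>?U (fst z) (snd z) - W (fst z) (snd z)\<bar> \<partial>lborel))"
      proof (rule cut_le_L1, rule discretize_L1_le[OF pos borel_measurable_step_graphon])
        show "0 \<le> ?U x y \<and> ?U x y \<le> 1" for x y
          unfolding step_graphon_def by (rule D01)
        show "(\<lambda>z. W (fst z) (snd z)) \<in> borel_measurable borel" "0 \<le> W x y \<and> W x y \<le> 1" for x y
          using W unfolding asym_graphon_def by blast+
      qed
      have "cut_le (m' k) (n' k) (\<lambda>z. P (r k) (\<sigma> (r k) (fst z)) (\<tau> (r k) (snd z))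
          - discretize (m' k) (n' k) W (fst z) (snd z))
        (1 / real (Suc t) + (\<delta> k + 2 ^ ?N / real (m' k) + 2 ^ ?N / real (n' k)) +
          4 * (\<integral>z. indicator unit_square z *
            \<bar>?U (fst z) (snd z) - W (fst z) (snd z)\<bar> \<partial>lborel))"
        by (rule cut_le_cong[OF cut_le_add[OF cut_le_add[OF 1 2] 3]]) (simp add: f_def A_def)
      then have "delta_box (m' k) (n' k) (P (r k)) (discretize (m' k) (n' k) W) \<le>
        1 / real (Suc t) + (\<delta> k + 2 ^ ?N / real (m' k) + 2 ^ ?N / real (n' k)) +
          4 * (\<integral>z. indicator unit_square z *
            \<bar>?U (fst z) (snd z) - W (fst z) (snd z)\<bar> \<partial>lborel)"
        using \<sigma>[of "r k"] \<tau>[of "r k"] pos unfolding m'_def n'_def by (intro delta_box_le)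
      also have "\<dots> < \<epsilon> / 4 + \<epsilon> / 2 + 4 * (\<epsilon> / 16)"
        using small elim(1) I by linarith
      also have "\<dots> = \<epsilon>" by simp
      finally show ?case by (simp add: delta_box_graphon_def m'_def n'_def)
    qed
  qed
  with r W show ?thesis by blast
qed

end
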